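(* Let $\mathbb{R}^n=\mathbb{R}^{2d}$ be endowed with its canonical symplectic form and associated Poisson bracket, and let $A,B\in\operatorname{Sym}(n,\mathbb{R})$ form a non-dissipative pair. Define $C\in\operatorname{Sym}(n,\mathbb{R})$ by $Q_C:=\{Q_A,Q_B\}$, and assume $A,B,C$ are linearly independent. Suppose one of the following holds: (i) $\operatorname{minrank}\{A,B\}\ge3$ and $\operatorname{maxrank}\{A,B\}\ge17$; (ii) $\operatorname{minrank}\{A,B\}=2$, $\operatorname{maxrank}\{A,B\}\ge9$, and $\ker A\cap\ker B$ is either $\{0\}$ or a symplectic subspace of $\mathbb{R}^n$. Then there exists $x\in\mathbb{R}^n$ with $Q_A(x)=Q_B(x)=0$ and $Q_C(x)\ne0$.
   Context: $Q_M(z)={}^tzMz$ for $M\in\operatorname{Sym}(n,\mathbb{R})$. Canonical symplectic structure on $\mathbb{R}^{2d}$ with coordinates $(x,\xi)$: $\sigma=\sum_j d\xi_j\wedge dx_j$, Poisson bracket $\{a,b\}=\sum_j(\partial_{\xi_j}a\,\partial_{x_j}b-\partial_{x_j}a\,\partial_{\xi_j}b)$. $A,B$ form a non-dissipative pair if $0$ is the only positive semidefinite element of $\operatorname{span}_{\mathbb{R}}\{A,B\}$. $\operatorname{maxrank}\{A,B\}$ is the maximal rank of elements of $\operatorname{span}_{\mathbb{R}}\{A,B\}$; $\operatorname{minrank}\{A,B\}$ is the minimal rank of nonzero elements of it. *)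

theory Defs
  imports "HOL-Analysis.Analysis"
begin

text \<open>Phase space R^n = R^{2d} is modelled as real^('d + 'd): the coordinate
  Inl j is x_j and the coordinate Inr j is xi_j (j ranges over the finite type 'd,
  so d = CARD('d)). Matrices are real^('d+'d)^('d+'d).\<close>

type_synonym 'd phase = "real ^ ('d + 'd)"
type_synonym 'd pmat = "real ^ ('d + 'd) ^ ('d + 'd)"

definition symmetric_mat :: "'d::finite pmat \<Rightarrow> bool" where
  "symmetric_mat M \<longleftrightarrow> transpose M = M"

definition Q :: "'d::finite pmat \<Rightarrow> 'd phase \<Rightarrow> real" where
  "Q M z = z \<bullet> (M *v z)"

definition pderiv_coord :: "('d::finite phase \<Rightarrow> real) \<Rightarrow> ('d + 'd) \<Rightarrow> 'd phase \<Rightarrow> real" where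
  "pderiv_coord f k z = frechet_derivative f (at z) (axis k 1)"

definition poisson :: "('d::finite phase \<Rightarrow> real) \<Rightarrow> ('d phase \<Rightarrow> real) \<Rightarrow> 'd phase \<Rightarrow> real" where
  "poisson a b z = (\<Sum>j\<in>UNIV. pderiv_coord a (Inr j) z * pderiv_coord b (Inl j) z
                              - pderiv_coord a (Inl j) z * pderiv_coord b (Inr j) z)"

definition sigma :: "'d::finite phase \<Rightarrow> 'd phase \<Rightarrow> real" where
  "sigma z w = (\<Sum>j\<in>UNIV. z $ Inr j * w $ Inl j - w $ Inr j * z $ Inl j)"

definition symplectic_subspace :: "'d::finite phase set \<Rightarrow> bool" where
  "symplectic_subspace V \<longleftrightarrow> subspace V \<and>
     (\<forall>u\<in>V. (\<forall>v\<in>V. sigma u v = 0) \<longrightarrow> u = 0)"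

definition psd :: "'d::finite pmat \<Rightarrow> bool" where
  "psd M \<longleftrightarrow> (\<forall>z. Q M z \<ge> 0)"

definition span2 :: "'d::finite pmat \<Rightarrow> 'd pmat \<Rightarrow> 'd pmat set" where
  "span2 A B = {s *\<^sub>R A + t *\<^sub>R B | s t. True}"

definition non_dissipative_pair :: "'d::finite pmat \<Rightarrow> 'd pmat \<Rightarrow> bool" where
  "non_dissipative_pair A B \<longleftrightarrow> (\<forall>M\<in>span2 A B. psd M \<longrightarrow> M = 0)"

definition maxrank :: "'d::finite pmat \<Rightarrow> 'd pmat \<Rightarrow> nat" where
  "maxrank A B = Max (rank ` span2 A B)"

definition minrank :: "'d::finite pmat \<Rightarrow> 'd pmat \<Rightarrow> nat" where
  "minrank A B = Min (rank ` (span2 A B - {0}))"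

definition ker :: "'d::finite pmat \<Rightarrow> 'd phase set" where
  "ker M = {z. M *v z = 0}"

end

theory Submission
  imports Defs
begin

text \<open>
  Suppose \<open>Q C\<close> vanishes on the set \<open>Z\<close> of common zeros of \<open>Q A\<close> and \<open>Q B\<close>; we show that \<open>C\<close>
  lies in the span of \<open>A\<close> and \<open>B\<close>.

  In case (i), \<open>Z\<close> contains a point \<open>x\<close> at which \<open>A x\<close> and \<open>B x\<close> are independent. Since
  \<open>Q C = 0\<close> on \<open>Z\<close>, the vector \<open>C x\<close> is a combination of \<open>A x\<close> and \<open>B x\<close>, so after subtracting an
  element of the pencil we may assume \<open>C x = 0\<close>. Intersecting \<open>Z\<close> with lines through \<open>x\<close> shows that
  \<open>Q C\<close> vanishes on the cubic \<open>(A x \<bullet> y) Q B y = (B x \<bullet> y) Q A y\<close>. As some matrix of the pencil has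
  at least two positive and two negative eigenvalues, sufficiently many lines meet this cubic in
  three real points to conclude \<open>C = 0\<close>.

  In case (ii), a matrix \<open>L\<close> of rank two in the pencil has \<open>Q L z = (a1 \<bullet> z) (a2 \<bullet> z)\<close>. If a second
  generator \<open>B\<close> of the pencil is indefinite on both hyperplanes \<open>a1 \<bullet> z = 0\<close> and \<open>a2 \<bullet> z = 0\<close>, then
  \<open>Q C\<close> vanishes on both and is a multiple of \<open>Q L\<close>. Otherwise \<open>J a1\<close> or \<open>J a2\<close> is a nonzero vector
  of \<open>ker A \<inter> ker B\<close> in the radical of \<open>sigma\<close> restricted to this space.
\<close>

section \<open>Quadratic forms and Finsler's lemma\<close>

definition bil :: "real^'n^'n \<Rightarrow> real^'n \<Rightarrow> real^'n \<Rightarrow> real" where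
  "bil M x y = x \<bullet> (M *v y)"

abbreviation qf :: "real^'n^'n \<Rightarrow> real^'n \<Rightarrow> real" where
  "qf M x \<equiv> bil M x x"

lemma bil_simps [simp]:
  "bil M (x + x') y = bil M x y + bil M x' y"
  "bil M (x - x') y = bil M x y - bil M x' y"
  "bil M (c *\<^sub>R x) y = c * bil M x y"
  "bil M (- x) y = - bil M x y"
  "bil M 0 y = 0"
  "bil M x (y + y') = bil M x y + bil M x y'"
  "bil M x (y - y') = bil M x y - bil M x y'"
  "bil M x (c *\<^sub>R y) = c * bil M x y"
  "bil M x (- y) = - bil M x y"
  "bil M x 0 = 0"
  "bil (M + N) x y = bil M x y + bil N x y"
  "bil (M - N) x y = bil M x y - bil N x y"
  "bil (c *\<^sub>R M) x y = c * bil M x y"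
  "bil (- M) x y = - bil M x y"
  "bil 0 x y = 0"
  using scaleR_matrix_vector_assoc[of c M y, symmetric]
    matrix_vector_mult_diff_rdistrib[of 0 M y] matrix_vector_mult_diff_distrib[of M 0 y]
  by (simp_all add: bil_def inner_left_distrib inner_diff_left inner_diff_right inner_right_distrib
      matrix_vector_right_distrib matrix_vector_mult_diff_distrib matrix_vector_mult_scaleR
      matrix_vector_mult_add_rdistrib matrix_vector_mult_diff_rdistrib)

lemma bil_sum_right: "bil M x (\<Sum>i\<in>I. f i) = (\<Sum>i\<in>I. bil M x (f i))"
  by (induction I rule: infinite_finite_induct) auto

lemma bil_commute:
  assumes "transpose M = M" shows "bil M x y = bil M y x"
  unfolding bil_def by (metis assms dot_lmul_matrix inner_commute vector_transpose_matrix)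

lemma inner_mult_eq_bil:
  assumes "transpose M = M" shows "(M *v x) \<bullet> y = bil M x y"
  unfolding bil_commute[OF assms, of x y] by (simp add: bil_def inner_commute)

lemma qf_add_scaleR:
  assumes "transpose M = M"
  shows "qf M (x + t *\<^sub>R y) = qf M x + 2 * t * bil M x y + t\<^sup>2 * qf M y"
  using bil_commute[OF assms, of y x] by (simp add: algebra_simps power2_eq_square)

lemma polarization:
  assumes "transpose M = M" "subspace S" "\<And>z. z \<in> S \<Longrightarrow> qf M z = 0" "x \<in> S" "y \<in> S"
  shows "bil M x y = 0"
  using assms(3)[of "x + 1 *\<^sub>R y"] assms(2-5) qf_add_scaleR[OF assms(1), of x 1 y]
  by (simp add: subspace_add)

lemma matrix_eq_0_iff_qf:
  assumes "transpose M = M"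
  shows "M = 0 \<longleftrightarrow> (\<forall>z. qf M z = 0)"
proof
  assume "\<forall>z. qf M z = 0"
  then have "bil M x y = 0" for x y
    using polarization[OF assms subspace_UNIV] by blast
  then have "M *v y = 0" for y
    unfolding bil_def by (metis inner_eq_zero_iff)
  then show "M = 0" by (simp add: matrix_eq)
qed simp

text \<open>Since \<open>a * c < 0\<close>, half the root of the discriminant, \<open>d\<close>,
  exceeds the absolute value of \<open>b\<close>: the roots have opposite signs, and half the
  derivative there, \<open>b + r * a\<close>, is plus or minus \<open>d\<close>. With
  \<open>b = bil M x y\<close> this locates the zeros of \<open>qf M\<close> on a line
  \<open>x + r y\<close>; their simplicity later yields regular zeros.\<close>

lemma quadratic_roots_opposite_sign:
  fixes a b c :: real
  assumes "a * c < 0"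
  obtains r s where "r < 0" "0 < s" "c + 2 * r * b + r\<^sup>2 * a = 0" "c + 2 * s * b + s\<^sup>2 * a = 0"
    "b + r * a \<noteq> 0" "b + s * a \<noteq> 0" "r * s * a = c"
proof -
  define d where "d = sqrt (b\<^sup>2 - a * c)"
  have a: "a \<noteq> 0" using assms by auto
  have "a * c \<le> b\<^sup>2" using assms zero_le_power2[of b] by linarith
  then have d2: "d\<^sup>2 = b\<^sup>2 - a * c" unfolding d_def by simp
  have d: "d > \<bar>b\<bar>" unfolding d_def using assms by (intro real_less_rsqrt) simp
  let ?r = "(- b - d) / a" and ?s = "(- b + d) / a"
  have root: "c + 2 * ((- b + e) / a) * b + ((- b + e) / a)\<^sup>2 * a = 0" if "e\<^sup>2 = b\<^sup>2 - a * c" for e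
    using a that by (simp add: field_simps power2_eq_square) algebra
  have r: "c + 2 * ?r * b + ?r\<^sup>2 * a = 0" using root[of "- d"] d2 by simp
  have s: "c + 2 * ?s * b + ?s\<^sup>2 * a = 0" using root[of d] d2 by simp
  have nz: "b + ?r * a \<noteq> 0" "b + ?s * a \<noteq> 0" using a d by auto
  have prod: "?r * ?s * a = c" "?s * ?r * a = c"
    using a d2 by (simp_all add: field_simps power2_eq_square) (metis distrib_left)+
  show ?thesis
  proof (cases "a > 0")
    case True
    then show ?thesis using that[of ?r ?s] r s nz prod d by (auto simp: divide_simps)
  next
    case False
    then have "a < 0" using a by simp
    then show ?thesis using that[of ?s ?r] r s nz prod d by (auto simp: divide_simps)
  qed
qed

text \<open>If \<open>qf M a > 0 > qf M b\<close>, then \<open>qf M\<close> has two zeros on the line \<open>a + s b\<close>; a weighted sum of the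
  values of \<open>qf N\<close> there gives \<open>qf N b / qf M b \<le> qf N a / qf M a\<close>, and \<open>- t\<close> is any number
  separating these two families of quotients.\<close>

lemma finsler:
  assumes sym: "transpose M = M" "transpose N = N" and H: "subspace H"
    and u: "u \<in> H" "qf M u > 0" and v: "v \<in> H" "qf M v < 0"
    and nonneg: "\<And>z. z \<in> H \<Longrightarrow> qf M z = 0 \<Longrightarrow> qf N z \<ge> 0"
  obtains t where "\<And>z. z \<in> H \<Longrightarrow> qf N z + t * qf M z \<ge> 0"
proof -
  have slope: "qf N b / qf M b \<le> qf N a / qf M a"
    if a: "a \<in> H" "qf M a > 0" and b: "b \<in> H" "qf M b < 0" for a b
  proof -
    have "qf M b * qf M a < 0" using a b by (simp add: mult_neg_pos)
    then obtain r s where rs: "r < 0" "0 < s"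
      "qf M a + 2 * r * bil M a b + r\<^sup>2 * qf M b = 0"
      "qf M a + 2 * s * bil M a b + s\<^sup>2 * qf M b = 0"
      "r * s * qf M b = qf M a"
      by (metis quadratic_roots_opposite_sign)
    have "qf N (a + r *\<^sub>R b) \<ge> 0" "qf N (a + s *\<^sub>R b) \<ge> 0"
      using rs a b H qf_add_scaleR[OF sym(1), of a _ b]
      by (metis nonneg subspace_add subspace_scale)+
    \<comment> \<open>The positive weights \<open>s\<close> and \<open>- r\<close> cancel the mixed
      term \<open>bil N a b\<close>.\<close>
    then have "s * qf N (a + r *\<^sub>R b) + (- r) * qf N (a + s *\<^sub>R b) \<ge> 0"
      using rs by (intro add_nonneg_nonneg mult_nonneg_nonneg) auto
    then have "(s - r) * (qf N a - r * s * qf N b) \<ge> 0"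
      unfolding qf_add_scaleR[OF sym(2)] by (simp add: algebra_simps power2_eq_square)
    then have "qf N a - r * s * qf N b \<ge> 0"
      using rs by (simp add: zero_le_mult_iff)
    moreover have "r * s = qf M a / qf M b"
      using rs(5) b by (simp add: field_simps)
    ultimately show ?thesis using a b by (simp add: field_simps)
  qed
  define T where "T = (\<lambda>b. qf N b / qf M b) ` {b \<in> H. qf M b < 0}"
  have ne: "T \<noteq> {}" using v by (auto simp: T_def)
  have bdd: "bdd_above T" unfolding bdd_above_def T_def using slope[OF u] by blast
  show ?thesis
  proof (rule that)
    fix z assume z: "z \<in> H"
    consider "qf M z = 0" | "qf M z > 0" | "qf M z < 0" by linarith
    then show "qf N z + (- Sup T) * qf M z \<ge> 0"
    proof cases
      case 1 then show ?thesis using nonneg z by simp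
    next
      case 2
      have "Sup T \<le> qf N z / qf M z"
        by (intro cSup_least ne) (use slope[OF z 2] in \<open>auto simp: T_def\<close>)
      with 2 show ?thesis by (simp add: field_simps)
    next
      case 3
      have "qf N z / qf M z \<le> Sup T"
        by (intro cSup_upper bdd) (use z 3 in \<open>auto simp: T_def\<close>)
      with 3 show ?thesis by (simp add: field_simps)
    qed
  qed
qed

text \<open>Finsler's lemma for \<open>N\<close> and for \<open>- N\<close> bounds
  \<open>qf N\<close> on both sides by multiples of \<open>qf M\<close>. Adding the bounds makes
  \<open>(s + t) * qf M\<close> nonnegative on \<open>H\<close>, and since \<open>qf M\<close> takes
  both signs there, \<open>s = - t\<close>.\<close>

lemma proportional_on_indefinite:
  assumes sym: "transpose M = M" "transpose N = N" and H: "subspace H"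
    and u: "u \<in> H" "qf M u > 0" and v: "v \<in> H" "qf M v < 0"
    and zero: "\<And>z. z \<in> H \<Longrightarrow> qf M z = 0 \<Longrightarrow> qf N z = 0"
  obtains t where "\<And>z. z \<in> H \<Longrightarrow> qf N z = t * qf M z"
proof -
  obtain t where t: "\<And>z. z \<in> H \<Longrightarrow> qf N z + t * qf M z \<ge> 0"
    using finsler[OF sym H u v] zero by (metis order_refl)
  have "transpose (- N) = - N" using sym(2) by (simp add: transpose_def vec_eq_iff)
  then obtain s where s: "\<And>z. z \<in> H \<Longrightarrow> qf (- N) z + s * qf M z \<ge> 0"
    using finsler[OF sym(1) _ H u v, of "- N"] zero by (metis bil_simps(14) neg_0_equal_iff_equal order_refl)
  have "(s + t) * qf M u \<ge> 0" "(s + t) * qf M v \<ge> 0"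
    using t[OF u(1)] s[OF u(1)] t[OF v(1)] s[OF v(1)] by (simp_all add: algebra_simps)
  then have "s = - t" using u v by (auto simp: zero_le_mult_iff)
  then have "qf N z = (- t) * qf M z" if "z \<in> H" for z using t[OF that] s[OF that] by simp
  then show ?thesis by (rule that)
qed

section \<open>Rank and signature in a pencil\<close>

lemma continuous_on_bil [continuous_intros]:
  fixes M :: "real^'n^'n"
  assumes "continuous_on S f" "continuous_on S g"
  shows "continuous_on S (\<lambda>x. bil M (f x) (g x))"
proof -
  have "continuous_on S (\<lambda>x. M *v g x)"
    using continuous_on_compose2[OF linear_continuous_on assms(2), of "(*v) M" UNIV]
    by (simp add: linear_conv_bounded_linear[symmetric])
  with assms(1) show ?thesis unfolding bil_def by (intro continuous_intros)
qed

lemma transpose_combination: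
  fixes A B :: "real^'n^'n"
  assumes "transpose A = A" "transpose B = B"
  shows "transpose (s *\<^sub>R A + t *\<^sub>R B) = s *\<^sub>R A + t *\<^sub>R B" "transpose (- A) = - A"
  using assms by (simp_all add: transpose_def vec_eq_iff)

section \<open>Dimension counts for orthogonal complements and isotropic subspaces\<close>

lemma dim_orthogonal_complement:
  fixes S :: "'a::euclidean_space set"
  assumes "subspace S"
  shows "dim {y. \<forall>x\<in>S. x \<bullet> y = 0} + dim S = DIM('a)"
  using dim_subspace_orthogonal_to_vectors[OF assms subspace_UNIV] by (simp add: orthogonal_def)

lemma dim_orthogonal_to_finite_ge:
  fixes X :: "'a::euclidean_space set"
  assumes "finite X"
  shows "DIM('a) \<le> dim {y. \<forall>x\<in>X. x \<bullet> y = 0} + card X"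
proof -
  have "{y. \<forall>x\<in>X. x \<bullet> y = 0} = {y. \<forall>x\<in>span X. x \<bullet> y = 0}"
    using orthogonal_to_span[of _ X] by (auto simp: orthogonal_def span_base) (metis inner_commute)
  then show ?thesis
    using dim_orthogonal_complement[of "span X"] dim_le_card[OF _ assms, of X]
    by (simp add: span_superset)
qed

lemma subspace_orthogonal: "subspace {y. \<forall>x\<in>X. x \<bullet> y = 0}"
  by (auto simp: subspace_def inner_right_distrib)

lemma rank_nullity:
  fixes M :: "real^'n^'m"
  shows "dim {x. M *v x = 0} + rank M = CARD('n)"
proof -
  have "M *v x = 0" if "\<forall>y\<in>span (rows M). y \<bullet> x = 0" for x
  proof -
    have "row i M \<bullet> x = 0" for i using that by (auto simp: rows_def intro: span_base)
    then show ?thesis by (simp add: vec_eq_iff matrix_vector_mul_component row_def vec_lambda_eta)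
  qed
  then have "{x. M *v x = 0} = {x. \<forall>y\<in>span (rows M). y \<bullet> x = 0}"
    using orthogonal_nullspace_rowspace[of M] by (auto simp: orthogonal_def inner_commute)
  then show ?thesis
    using dim_orthogonal_complement[of "span (rows M)"] by (simp add: row_rank_def)
qed

text \<open>By polarization \<open>M\<close> maps \<open>W\<close> into its orthogonal complement
  \<open>U\<close>. As the whole space is \<open>W + U\<close>, the range of \<open>M\<close> is the
  sum of the images of \<open>W\<close> and \<open>U\<close>, each of dimension at most
  \<open>dim U\<close>.\<close>

lemma rank_isotropic_subspace:
  fixes M :: "real^'n^'n"
  assumes "transpose M = M" "subspace W" "\<And>x. x \<in> W \<Longrightarrow> qf M x = 0"
  shows "rank M + 2 * dim W \<le> 2 * CARD('n)"
proof -
  define U where "U = {y. \<forall>x\<in>W. x \<bullet> y = 0}"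
  have U: "subspace U" unfolding U_def by (rule subspace_orthogonal)
  have dU: "dim U + dim W = CARD('n)"
    using dim_orthogonal_complement[OF assms(2)] by (simp add: U_def)
  have lin: "linear ((*v) M)" by simp
  have "(*v) M ` W \<subseteq> U"
    using polarization[OF assms(1,2)] assms(3) by (auto simp: U_def bil_def[symmetric])
  then have dW: "dim ((*v) M ` W) \<le> dim U" by (rule dim_subset)
  have "range ((*v) M) \<subseteq> {a + b |a b. a \<in> (*v) M ` W \<and> b \<in> (*v) M ` U}"
  proof clarsimp
    fix z
    obtain y w where yw: "y \<in> span W" "\<And>u. u \<in> span W \<Longrightarrow> orthogonal w u" "z = y + w"
      using orthogonal_subspace_decomp_exists by blast
    have "y \<in> W" using yw(1) assms(2) by (metis span_eq_iff)
    moreover have "w \<in> U" using yw(2) by (auto simp: U_def orthogonal_def inner_commute span_base)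
    ultimately show "\<exists>a b. M *v z = a + b \<and> a \<in> (*v) M ` W \<and> b \<in> (*v) M ` U"
      using yw(3) by (auto simp: matrix_vector_right_distrib)
  qed
  then have "rank M \<le> dim {a + b |a b. a \<in> (*v) M ` W \<and> b \<in> (*v) M ` U}"
    unfolding rank_dim_range by (rule dim_subset)
  also have "\<dots> \<le> dim ((*v) M ` W) + dim ((*v) M ` U)"
    using dim_sums_Int[OF linear_subspace_image[OF lin assms(2)] linear_subspace_image[OF lin U]]
    by simp
  also have "\<dots> \<le> dim U + dim U"
    using dW dim_image_le[OF lin, of U] by simp
  finally show ?thesis using dU by simp
qed

text \<open>The non-isotropic part of a basis diagonalising \<open>M\<close>. The signs of
  \<open>qf M\<close> on such a system replace the signs of eigenvalues.\<close>

definition orthogonal_system :: "real^'n^'n \<Rightarrow> (real^'n) set \<Rightarrow> bool" where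
  "orthogonal_system M X \<longleftrightarrow> finite X \<and> (\<forall>x\<in>X. qf M x \<noteq> 0) \<and>
     (\<forall>x\<in>X. \<forall>y\<in>X. x \<noteq> y \<longrightarrow> bil M x y = 0)"

lemma orthogonal_system_coeff:
  assumes "orthogonal_system M X" "x \<in> X"
  shows "bil M x (\<Sum>y\<in>X. c y *\<^sub>R y) = c x * qf M x"
proof -
  have "bil M x (\<Sum>y\<in>X. c y *\<^sub>R y) = (\<Sum>y\<in>X. c y * bil M x y)"
    by (simp add: bil_sum_right)
  also have "\<dots> = (\<Sum>y\<in>X. if y = x then c x * qf M x else 0)"
    using assms by (intro sum.cong) (auto simp: orthogonal_system_def)
  finally show ?thesis using assms by (simp add: orthogonal_system_def)
qed

lemma orthogonal_system_independent:
  assumes "orthogonal_system M X"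
  shows "independent X"
proof -
  have "c x = 0" if "(\<Sum>y\<in>X. c y *\<^sub>R y) = 0" "x \<in> X" for c x
    using orthogonal_system_coeff[OF assms that(2), of c] that assms by (auto simp: orthogonal_system_def)
  then show ?thesis using assms by (auto simp: dependent_finite orthogonal_system_def)
qed

text \<open>Pairing with the elements of \<open>X\<close> recovers the coefficients of a vector of
  \<open>span X\<close>, so \<open>span X\<close> meets the kernel of \<open>M\<close> only in
  0.\<close>

lemma orthogonal_system_card_le_rank:
  fixes M :: "real^'n^'n"
  assumes X: "orthogonal_system M X"
  shows "card X \<le> rank M"
proof -
  have fin: "finite X" using X by (simp add: orthogonal_system_def)
  let ?K = "{v. M *v v = 0}"
  have K: "subspace ?K"
    by (auto simp: subspace_def matrix_vector_right_distrib matrix_vector_mult_scaleR)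
  have "v = 0" if v: "v \<in> span X" "M *v v = 0" for v
  proof -
    obtain c where c: "v = (\<Sum>y\<in>X. c y *\<^sub>R y)" using v(1) span_finite[OF fin] by auto
    have "c x = 0" if "x \<in> X" for x
    proof -
      have "c x * qf M x = bil M x v" using orthogonal_system_coeff[OF X that, of c] c by simp
      then show ?thesis using v(2) X that by (simp add: bil_def orthogonal_system_def)
    qed
    then show "v = 0" unfolding c by (intro sum.neutral) auto
  qed
  then have "span X \<inter> ?K \<subseteq> {0}" by blast
  then have "dim (span X \<inter> ?K) = 0" by (simp add: dim_eq_0)
  moreover have "dim {x + y |x y. x \<in> span X \<and> y \<in> ?K} \<le> CARD('n)"
    using dim_subset_UNIV[of "{x + y |x y. x \<in> span X \<and> y \<in> ?K}"] by simp
  moreover have "dim (span X) = card X"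
    using orthogonal_system_independent[OF X] by (simp add: dim_eq_card_independent)
  ultimately show ?thesis
    using dim_sums_Int[OF subspace_span[of X] K] rank_nullity[of M] by linarith
qed

text \<open>Every \<open>z\<close> is a projection \<open>p\<close> in the span of \<open>X\<close>
  plus a vector \<open>M\<close>-orthogonal to \<open>X\<close>. The vector \<open>y\<close> is
  \<open>M\<close>-orthogonal to \<open>p\<close> by assumption and to the remainder by
  polarization.\<close>

lemma orthogonal_system_remainder_kernel:
  assumes M: "transpose M = M" and X: "orthogonal_system M X"
    and iso: "\<And>y. \<forall>x\<in>X. bil M x y = 0 \<Longrightarrow> qf M y = 0" and y: "\<forall>x\<in>X. bil M x y = 0"
  shows "M *v y = 0"
proof -
  define T where "T = {y. \<forall>x\<in>X. bil M x y = 0}"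
  have T: "subspace T" by (auto simp: T_def subspace_def)
  have "bil M z y = 0" for z
  proof -
    define p where "p = (\<Sum>x\<in>X. (bil M x z / qf M x) *\<^sub>R x)"
    have "bil M x (z - p) = 0" if "x \<in> X" for x
      using orthogonal_system_coeff[OF X that, of "\<lambda>x. bil M x z / qf M x"] X that
      by (simp add: p_def orthogonal_system_def)
    then have zp: "z - p \<in> T" by (simp only: T_def mem_Collect_eq) blast
    have yT: "y \<in> T" using y by (simp only: T_def mem_Collect_eq)
    have "qf M w = 0" if "w \<in> T" for w using that iso by (simp only: T_def mem_Collect_eq)
    from polarization[OF M T this yT zp] have "bil M y (z - p) = 0" .
    moreover have "bil M y p = 0"
      unfolding p_def bil_sum_right using y
      by (intro sum.neutral) (metis M bil_commute bil_simps(8) mult_zero_right)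
    ultimately show ?thesis using bil_commute[OF M, of z y] by simp
  qed
  then show ?thesis unfolding bil_def by (metis inner_eq_zero_iff)
qed

text \<open>If a system of \<open>r < rank M\<close> vectors could not be extended, its
  \<open>M\<close>-orthogonal complement, of codimension at most \<open>r\<close>, would lie in the
  kernel of \<open>M\<close>, whose codimension is \<open>rank M\<close>.\<close>

lemma exists_orthogonal_system:
  fixes M :: "real^'n^'n"
  assumes M: "transpose M = M" and "r \<le> rank M"
  shows "\<exists>X. orthogonal_system M X \<and> card X = r"
  using assms(2)
proof (induction r)
  case 0
  then show ?case by (intro exI[of _ "{}"]) (simp add: orthogonal_system_def)
next
  case (Suc r)
  then obtain X where X: "orthogonal_system M X" "card X = r" by auto
  have fin: "finite X" using X by (simp add: orthogonal_system_def)
  have "\<exists>y. qf M y \<noteq> 0 \<and> (\<forall>x\<in>X. bil M x y = 0)"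
  proof (rule ccontr)
    assume "\<not> ?thesis"
    then have "{y. \<forall>x\<in>X. bil M x y = 0} \<subseteq> {y. M *v y = 0}"
      using orthogonal_system_remainder_kernel[OF M X(1)] by blast
    moreover have "bil M x y = (M *v x) \<bullet> y" for x y
      using bil_commute[OF M, of x y] by (simp add: bil_def inner_commute)
    then have "{y. \<forall>x\<in>X. bil M x y = 0} = {y. \<forall>w\<in>(*v) M ` X. w \<bullet> y = 0}"
      by simp
    ultimately have "dim {y. \<forall>w\<in>(*v) M ` X. w \<bullet> y = 0} \<le> dim {y. M *v y = 0}"
      using dim_subset[of "{y. \<forall>x\<in>X. bil M x y = 0}" "{y. M *v y = 0}"] by simp
    moreover have "CARD('n) \<le> dim {y. \<forall>w\<in>(*v) M ` X. w \<bullet> y = 0} + card ((*v) M ` X)"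
      using dim_orthogonal_to_finite_ge[of "(*v) M ` X"] fin by simp
    ultimately show False
      using rank_nullity[of M] card_image_le[OF fin, of "(*v) M"] X(2) Suc.prems by linarith
  qed
  then obtain y where y: "qf M y \<noteq> 0" "\<forall>x\<in>X. bil M x y = 0" by blast
  then have "y \<notin> X" by auto
  then have "card (insert y X) = Suc r" using fin X by simp
  moreover have "orthogonal_system M (insert y X)"
    using X y by (auto simp: orthogonal_system_def) (metis M bil_commute)
  ultimately show ?case by blast
qed

text \<open>The positive index of inertia is at least \<open>k\<close>. Stating it with a positive
  definite subspace makes both the openness in \<open>M\<close> and the intersection with large
  subspaces direct.\<close>

definition pos_index_ge :: "nat \<Rightarrow> real^'n^'n \<Rightarrow> bool" where
  "pos_index_ge k M \<longleftrightarrow> (\<exists>S. subspace S \<and> dim S = k \<and> (\<forall>x\<in>S. x \<noteq> 0 \<longrightarrow> qf M x > 0))"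

lemma pos_index_ge_orthogonal_system:
  assumes M: "transpose M = M" and X: "orthogonal_system M X" and pos: "\<forall>x\<in>X. qf M x > 0"
  shows "pos_index_ge (card X) M"
  unfolding pos_index_ge_def
proof (intro exI[of _ "span X"] conjI ballI impI)
  have fin: "finite X" using X by (simp add: orthogonal_system_def)
  show "dim (span X) = card X"
    using orthogonal_system_independent[OF X] by (simp add: dim_eq_card_independent)
  fix v assume v: "v \<in> span X" "v \<noteq> 0"
  then obtain c where c: "v = (\<Sum>y\<in>X. c y *\<^sub>R y)" using span_finite[OF fin] by auto
  have "qf M v = bil M v (\<Sum>y\<in>X. c y *\<^sub>R y)" by (simp flip: c)
  also have "\<dots> = (\<Sum>y\<in>X. c y * bil M v y)" by (simp add: bil_sum_right)
  also have "\<dots> = (\<Sum>y\<in>X. c y * bil M y v)" by (metis M bil_commute)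
  also have "\<dots> = (\<Sum>y\<in>X. (c y)\<^sup>2 * qf M y)"
    using orthogonal_system_coeff[OF X, of _ c] by (intro sum.cong) (auto simp: c power2_eq_square)
  also have "\<dots> > 0"
  proof -
    have "\<exists>x\<in>X. c x \<noteq> 0"
    proof (rule ccontr)
      assume "\<not> ?thesis"
      then have "v = 0" unfolding c by (intro sum.neutral) auto
      with v(2) show False by simp
    qed
    then obtain x where "x \<in> X" "c x \<noteq> 0" by blast
    then show ?thesis using pos fin by (intro sum_pos2[of X x]) (auto simp: less_imp_le)
  qed
  finally show "qf M v > 0" .
qed simp

text \<open>Pigeonhole on a maximal orthogonal system: two sign classes with at most
  \<open>k - 1\<close> elements each would contain at most \<open>2 * k - 2 < rank M\<close>
  vectors.\<close>

lemma pos_index_ge_or_neg: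
  assumes M: "transpose M = M" and r: "2 * k \<le> rank M + 1"
  shows "pos_index_ge k M \<or> pos_index_ge k (- M)"
proof -
  obtain X where X: "orthogonal_system M X" "card X = rank M"
    using exists_orthogonal_system[OF M] by blast
  have fin: "finite X" using X by (simp add: orthogonal_system_def)
  define P N where "P = {x\<in>X. qf M x > 0}" and "N = {x\<in>X. qf M x < 0}"
  have "P \<union> N = X" "P \<inter> N = {}" using X by (auto simp: P_def N_def orthogonal_system_def)
  then have "card P + card N = rank M" using X(2) fin by (metis card_Un_disjoint finite_Un)
  then consider "k \<le> card P" | "k \<le> card N" using r by linarith
  then show ?thesis
  proof cases
    case 1
    then obtain Y where Y: "Y \<subseteq> P" "card Y = k" "finite Y" by (rule obtain_subset_with_card_n)
    then have "orthogonal_system M Y" "\<forall>x\<in>Y. qf M x > 0"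
      using X(1) by (auto simp: orthogonal_system_def P_def subset_iff)
    then show ?thesis using pos_index_ge_orthogonal_system[OF M] Y by blast
  next
    case 2
    then obtain Y where Y: "Y \<subseteq> N" "card Y = k" "finite Y" by (rule obtain_subset_with_card_n)
    then have "orthogonal_system (- M) Y" "\<forall>x\<in>Y. qf (- M) x > 0"
      using X(1) by (auto simp: orthogonal_system_def N_def subset_iff)
    then show ?thesis using pos_index_ge_orthogonal_system transpose_combination(2)[OF M M] Y by blast
  qed
qed

lemma pos_index_ge_meets:
  fixes M :: "real^'n^'n"
  assumes "pos_index_ge k M" "subspace H" "CARD('n) < dim H + k"
  obtains x where "x \<in> H" "qf M x > 0"
proof -
  obtain S where S: "subspace S" "dim S = k" "\<forall>x\<in>S. x \<noteq> 0 \<longrightarrow> qf M x > 0"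
    using assms(1) by (auto simp: pos_index_ge_def)
  have "dim {x + y |x y. x \<in> S \<and> y \<in> H} \<le> CARD('n)"
    using dim_subset_UNIV[of "{x + y |x y. x \<in> S \<and> y \<in> H}"] by simp
  then have "dim (S \<inter> H) \<noteq> 0" using dim_sums_Int[OF S(1) assms(2)] S(2) assms(3) by linarith
  then obtain x where "x \<in> S \<inter> H" "x \<noteq> 0" by (metis dim_eq_0 singletonI subsetI)
  then show ?thesis using that S(3) by blast
qed

text \<open>The same subspace \<open>S\<close> works for nearby coefficients: on its unit sphere the
  form is at least some \<open>c > 0\<close>, and changing each coefficient by less than
  \<open>c / D\<close> changes the value there by less than \<open>c\<close>.\<close>

lemma open_pos_index_ge:
  fixes A B :: "real^'n^'n"
  shows "open {z::real\<times>real. pos_index_ge k (fst z *\<^sub>R A + snd z *\<^sub>R B)}"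
  unfolding open_dist
proof
  fix z :: "real \<times> real"
  assume "z \<in> {z. pos_index_ge k (fst z *\<^sub>R A + snd z *\<^sub>R B)}"
  then obtain S where S: "subspace S" "dim S = k"
    "\<forall>x\<in>S. x \<noteq> 0 \<longrightarrow> qf (fst z *\<^sub>R A + snd z *\<^sub>R B) x > 0"
    by (auto simp: pos_index_ge_def)
  define K where "K = sphere 0 1 \<inter> S"
  have K: "compact K" unfolding K_def using S(1) by (simp add: closed_subspace compact_Int_closed)
  obtain c where c: "c > 0" "\<And>x. x \<in> K \<Longrightarrow> c \<le> fst z * qf A x + snd z * qf B x"
  proof (cases "K = {}")
    case True then show ?thesis using that[of 1] by simp
  next
    case False
    have "continuous_on K (\<lambda>x. fst z * qf A x + snd z * qf B x)" by (intro continuous_intros)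
    then obtain x0 where "x0 \<in> K" "\<forall>x\<in>K. fst z * qf A x0 + snd z * qf B x0 \<le> fst z * qf A x + snd z * qf B x"
      using continuous_attains_inf[OF K False] by blast
    moreover have "0 < fst z * qf A x0 + snd z * qf B x0" using S(3) \<open>x0 \<in> K\<close> by (auto simp: K_def)
    ultimately show ?thesis using that by blast
  qed
  have "bounded ((\<lambda>x. \<bar>qf A x\<bar> + \<bar>qf B x\<bar>) ` K)"
    by (intro compact_imp_bounded compact_continuous_image K continuous_intros)
  then obtain D where D: "D > 0" "\<And>x. x \<in> K \<Longrightarrow> \<bar>qf A x\<bar> + \<bar>qf B x\<bar> \<le> D"
    by (force simp: bounded_pos)
  show "\<exists>e>0. \<forall>y. dist y z < e \<longrightarrow> y \<in> {z. pos_index_ge k (fst z *\<^sub>R A + snd z *\<^sub>R B)}"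
  proof (intro exI[of _ "c / D"] conjI allI impI)
    show "c / D > 0" using c D by simp
    fix y :: "real \<times> real" assume y: "dist y z < c / D"
    have pos: "0 < fst y * qf A x + snd y * qf B x" if "x \<in> K" for x
    proof -
      have "\<bar>fst y - fst z\<bar> \<le> dist y z" "\<bar>snd y - snd z\<bar> \<le> dist y z"
        using dist_fst_le[of y z] dist_snd_le[of y z] by (simp_all add: dist_real_def)
      then have "\<bar>(fst y - fst z) * qf A x\<bar> + \<bar>(snd y - snd z) * qf B x\<bar>
          \<le> dist y z * \<bar>qf A x\<bar> + dist y z * \<bar>qf B x\<bar>"
        by (simp add: abs_mult add_mono mult_right_mono)
      also have "\<dots> \<le> dist y z * D"
        using D(2)[OF that] by (simp add: distrib_left[symmetric] mult_left_mono)
      also have "\<dots> < c" using y D(1) by (simp add: field_simps)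
      finally show ?thesis using c(2)[OF that] by (simp add: left_diff_distrib)
    qed
    have "qf (fst y *\<^sub>R A + snd y *\<^sub>R B) x > 0" if x: "x \<in> S" "x \<noteq> 0" for x
    proof -
      have "(1 / norm x) *\<^sub>R x \<in> K" using x S(1) by (simp add: K_def subspace_scale)
      from pos[OF this] have "0 < (fst y * qf A x + snd y * qf B x) / (norm x)\<^sup>2"
        using x by (simp add: field_simps power2_eq_square)
      then show ?thesis using x by (simp add: zero_less_divide_iff)
    qed
    then show "y \<in> {z. pos_index_ge k (fst z *\<^sub>R A + snd z *\<^sub>R B)}"
      using S by (auto simp: pos_index_ge_def)
  qed
qed

text \<open>The matrices of positive index \<open>\<ge> k\<close> and those of negative index \<open>\<ge> k\<close> form two open sets,
  swapped by \<open>z \<mapsto> - z\<close>, that cover the connected punctured plane; hence they intersect.\<close>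

lemma pencil_balanced_signature:
  fixes A B :: "real^'n^'n"
  assumes sym: "transpose A = A" "transpose B = B"
    and r: "\<And>s t. (s, t) \<noteq> (0, 0) \<Longrightarrow> 2 * k \<le> rank (s *\<^sub>R A + t *\<^sub>R B) + 1"
  defines "G \<equiv> {z::real\<times>real. pos_index_ge k (fst z *\<^sub>R A + snd z *\<^sub>R B) \<and>
                               pos_index_ge k (- (fst z *\<^sub>R A + snd z *\<^sub>R B))}"
  shows "open G" "G - {0} \<noteq> {}"
proof -
  define P where "P = {z::real\<times>real. pos_index_ge k (fst z *\<^sub>R A + snd z *\<^sub>R B)}"
  define N where "N = {z::real\<times>real. pos_index_ge k (fst z *\<^sub>R (- A) + snd z *\<^sub>R (- B))}"
  have neg: "fst z *\<^sub>R (- A) + snd z *\<^sub>R (- B) = - (fst z *\<^sub>R A + snd z *\<^sub>R B)" for z :: "real\<times>real"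
    by simp
  have G: "G = P \<inter> N" unfolding G_def P_def N_def neg by auto
  have op: "open P" "open N" unfolding P_def N_def by (rule open_pos_index_ge)+
  then show "open G" unfolding G by blast
  have cover: "- {0} \<subseteq> P \<union> N"
  proof
    fix z :: "real \<times> real" assume "z \<in> - {0}"
    then have "(fst z, snd z) \<noteq> (0, 0)" by (simp add: zero_prod_def)
    from pos_index_ge_or_neg[OF transpose_combination(1)[OF sym] r[OF this]]
    show "z \<in> P \<union> N" unfolding P_def N_def neg by blast
  qed
  have flip: "- z \<in> N \<longleftrightarrow> z \<in> P" "- z \<in> P \<longleftrightarrow> z \<in> N" for z unfolding P_def N_def by simp_all
  have "connected (- {0 :: real \<times> real})" by (rule connected_punctured_universe) simp
  then have "P \<inter> N \<inter> - {0} = {} \<Longrightarrow> P \<inter> - {0} = {} \<or> N \<inter> - {0} = {}"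
    using op cover unfolding connected_def by blast
  moreover have "P \<inter> - {0} \<noteq> {}" "N \<inter> - {0} \<noteq> {}"
  proof -
    have nz: "(1, 0) \<in> - {0 :: real \<times> real}" "(-1, 0) \<in> - {0 :: real \<times> real}" by (auto simp: zero_prod_def)
    have "(-1, 0) \<in> N \<longleftrightarrow> (1, 0) \<in> P" "(-1, 0) \<in> P \<longleftrightarrow> (1, 0) \<in> N"
      using flip[of "(1, 0)"] by simp_all
    then show "P \<inter> - {0} \<noteq> {}" "N \<inter> - {0} \<noteq> {}" using nz cover by blast+
  qed
  ultimately show "G - {0} \<noteq> {}" unfolding G by blast
qed

section \<open>Regular common zeros\<close>

text \<open>Non-dissipativity and linear independence of \<open>A\<close> and \<open>B\<close> in
  one condition, since the zero form is also nonnegative.\<close>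

definition indefinite_pencil :: "real^'n^'n \<Rightarrow> real^'n^'n \<Rightarrow> bool" where
  "indefinite_pencil A B \<longleftrightarrow> (\<forall>s t. (\<forall>z. 0 \<le> s * qf A z + t * qf B z) \<longrightarrow> s = 0 \<and> t = 0)"

text \<open>A point where the gradients \<open>2 A x\<close> and \<open>2 B x\<close> are
  independent, so that the common zero set is a smooth submanifold of codimension two near
  it.\<close>

definition regular_zero :: "real^'n^'n \<Rightarrow> real^'n^'n \<Rightarrow> real^'n \<Rightarrow> bool" where
  "regular_zero A B x \<longleftrightarrow> qf A x = 0 \<and> qf B x = 0 \<and>
     (\<forall>s t. s *\<^sub>R (A *v x) + t *\<^sub>R (B *v x) = 0 \<longrightarrow> s = 0 \<and> t = 0)"

lemma indefinite_pencil_minus: "indefinite_pencil A B \<Longrightarrow> indefinite_pencil A (- B)"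
  unfolding indefinite_pencil_def
proof (intro allI impI)
  fix s t
  assume ip: "\<forall>s t. (\<forall>z. 0 \<le> s * qf A z + t * qf B z) \<longrightarrow> s = 0 \<and> t = 0"
    and "\<forall>z. 0 \<le> s * qf A z + t * qf (- B) z"
  then have "\<forall>z. 0 \<le> s * qf A z + (- t) * qf B z" by simp
  with ip show "s = 0 \<and> t = 0" by (metis neg_equal_0_iff_equal)
qed

lemma regular_zero_minus: "regular_zero A (- B) x \<Longrightarrow> regular_zero A B x"
  unfolding regular_zero_def
proof (intro conjI allI impI)
  assume x: "qf A x = 0 \<and> qf (- B) x = 0 \<and>
     (\<forall>s t. s *\<^sub>R (A *v x) + t *\<^sub>R (- B *v x) = 0 \<longrightarrow> s = 0 \<and> t = 0)"
  then show "qf A x = 0" "qf B x = 0" by simp_all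
  fix s t assume "s *\<^sub>R (A *v x) + t *\<^sub>R (B *v x) = 0"
  moreover have "- B *v x = - (B *v x)"
    using matrix_vector_mult_diff_rdistrib[of 0 B x] by simp
  ultimately have "s *\<^sub>R (A *v x) + (- t) *\<^sub>R (- B *v x) = 0" by simp
  with x show "s = 0" "t = 0" by (metis neg_equal_0_iff_equal)+
qed

text \<open>Passing to \<open>a A + b B\<close> and \<open>- b A + a B\<close> is a rotation of the
  pencil up to scaling, with determinant \<open>a\<^sup>2 + b\<^sup>2\<close>. It lets any nonzero
  element serve as first generator.\<close>

lemma basis_change_entries:
  fixes A B :: "real^'n^'n"
  shows "s *\<^sub>R (a *\<^sub>R A + b *\<^sub>R B) + t *\<^sub>R (- b *\<^sub>R A + a *\<^sub>R B)
    = (s * a - t * b) *\<^sub>R A + (s * b + t * a) *\<^sub>R B"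
  by (simp add: algebra_simps)

lemma basis_change_nonzero:
  fixes a b s t :: real
  assumes "(a, b) \<noteq> (0, 0)" "s * a - t * b = 0" "s * b + t * a = 0"
  shows "s = 0 \<and> t = 0"
proof -
  have "s * (a\<^sup>2 + b\<^sup>2) = a * (s * a - t * b) + b * (s * b + t * a)"
    "t * (a\<^sup>2 + b\<^sup>2) = a * (s * b + t * a) - b * (s * a - t * b)"
    by (simp_all add: algebra_simps power2_eq_square)
  moreover have "a\<^sup>2 + b\<^sup>2 \<noteq> 0" using assms(1) by (simp add: sum_power2_eq_zero_iff)
  ultimately show ?thesis using assms(2,3) by (metis add_0 diff_0 minus_zero mult_eq_0_iff mult_zero_right)
qed

lemma indefinite_pencil_basis_change:
  assumes "indefinite_pencil A B" "(a, b) \<noteq> (0, 0)"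
  shows "indefinite_pencil (a *\<^sub>R A + b *\<^sub>R B) (- b *\<^sub>R A + a *\<^sub>R B)"
  unfolding indefinite_pencil_def
proof (intro allI impI)
  fix s t
  assume "\<forall>z. 0 \<le> s * qf (a *\<^sub>R A + b *\<^sub>R B) z + t * qf (- b *\<^sub>R A + a *\<^sub>R B) z"
  then have "\<forall>z. 0 \<le> (s * a - t * b) * qf A z + (s * b + t * a) * qf B z"
    by (simp add: algebra_simps)
  then have "s * a - t * b = 0 \<and> s * b + t * a = 0"
    using assms(1) unfolding indefinite_pencil_def by blast
  then show "s = 0 \<and> t = 0" using basis_change_nonzero[OF assms(2)] by blast
qed

lemma regular_zero_basis_change:
  assumes x: "regular_zero (a *\<^sub>R A + b *\<^sub>R B) (- b *\<^sub>R A + a *\<^sub>R B) x" and ab: "(a, b) \<noteq> (0, 0)"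
  shows "regular_zero A B x"
  unfolding regular_zero_def
proof (intro conjI allI impI)
  have "qf A x * a - (- qf B x) * b = 0" "qf A x * b + (- qf B x) * a = 0"
    using x by (simp_all add: regular_zero_def algebra_simps)
  from basis_change_nonzero[OF ab this] show "qf A x = 0" "qf B x = 0" by simp_all
  fix s t assume st: "s *\<^sub>R (A *v x) + t *\<^sub>R (B *v x) = 0"
  have "(s * a + t * b) *\<^sub>R ((a *\<^sub>R A + b *\<^sub>R B) *v x) + (t * a - s * b) *\<^sub>R ((- b *\<^sub>R A + a *\<^sub>R B) *v x)
      = (a * a + b * b) *\<^sub>R (s *\<^sub>R (A *v x) + t *\<^sub>R (B *v x))"
    by (simp add: matrix_vector_mult_add_rdistrib scaleR_matrix_vector_assoc[symmetric] algebra_simps)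
  also have "\<dots> = 0" using st by simp
  finally have "s * a + t * b = 0 \<and> t * a - s * b = 0" using x unfolding regular_zero_def by blast
  then show "s = 0" "t = 0" using basis_change_nonzero[OF ab, of t s] by (simp_all add: algebra_simps)
qed

lemma indefinite_pencil_witnesses:
  assumes "indefinite_pencil A B"
  obtains u v where "qf A u > 0" "qf A v < 0"
proof -
  have "\<exists>v. qf A v < 0" using assms[unfolded indefinite_pencil_def, rule_format, of 1 0]
    by (force simp: not_le)
  moreover have "\<exists>u. qf A u > 0" using assms[unfolded indefinite_pencil_def, rule_format, of "-1" 0]
    by (force simp: not_le)
  ultimately show ?thesis using that by blast
qed

lemma negative_near_zero:
  fixes f :: "real \<Rightarrow> real"
  assumes "continuous_on UNIV f" "f 0 < 0"
  obtains d where "d > 0" "\<forall>e. 0 < e \<and> e < d \<longrightarrow> f e < 0"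
proof -
  have "open {e. f e < 0}" by (intro open_Collect_less assms continuous_intros)
  then obtain d where d: "d > 0" "\<And>e. dist e 0 < d \<Longrightarrow> f e < 0"
    using assms(2) unfolding open_dist by force
  then have "\<forall>e. 0 < e \<and> e < d \<longrightarrow> f e < 0" by (simp add: dist_real_def)
  with d(1) show ?thesis by (rule that)
qed

text \<open>If \<open>qf N\<close> were nonnegative on the zeros of \<open>qf L\<close>, Finsler's
  lemma would give a nonnegative form \<open>N + t L\<close>. A zero \<open>z\<close> found in the
  kernel of \<open>L\<close> is moved off it by a small multiple of another zero \<open>w\<close> of
  \<open>qf L\<close> with \<open>L w\<close> nonzero; this keeps \<open>qf L\<close> zero because
  \<open>L z = 0\<close>.\<close>

lemma zero_with_negative_value:
  fixes L N :: "real^'n^'n"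
  assumes sym: "transpose L = L" "transpose N = N" and ip: "indefinite_pencil L N"
  obtains z where "qf L z = 0" "qf N z < 0" "L *v z \<noteq> 0"
proof -
  obtain u v where uv: "qf L u > 0" "qf L v < 0" using indefinite_pencil_witnesses[OF ip] .
  have "\<exists>z. qf L z = 0 \<and> qf N z < 0"
  proof (rule ccontr)
    assume "\<not> ?thesis"
    then obtain t where "\<And>z. z \<in> UNIV \<Longrightarrow> qf N z + t * qf L z \<ge> 0"
      using finsler[OF sym subspace_UNIV _ uv(1) _ uv(2)] by (metis UNIV_I not_le)
    then have "\<forall>z. 0 \<le> t * qf L z + 1 * qf N z" by (simp add: add.commute)
    then show False using ip unfolding indefinite_pencil_def by (metis zero_neq_one)
  qed
  then obtain z where z: "qf L z = 0" "qf N z < 0" by blast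
  show ?thesis
  proof (cases "L *v z = 0")
    case False then show ?thesis using that z by blast
  next
    case True
    have "qf L v * qf L u < 0" using uv by (simp add: mult_neg_pos)
    then obtain s where s: "qf L u + 2 * s * bil L u v + s\<^sup>2 * qf L v = 0" "bil L u v + s * qf L v \<noteq> 0"
      by (metis quadratic_roots_opposite_sign)
    define w where "w = u + s *\<^sub>R v"
    have w: "qf L w = 0" unfolding w_def using s qf_add_scaleR[OF sym(1)] by metis
    have "bil L w v \<noteq> 0" using s(2) by (simp add: w_def)
    then have Lw: "L *v w \<noteq> 0" using bil_commute[OF sym(1), of w v] by (auto simp: bil_def)
    have "continuous_on UNIV (\<lambda>e. qf N (z + e *\<^sub>R w))" by (intro continuous_intros)
    then obtain d :: real where "d > 0" "\<forall>e. 0 < e \<and> e < d \<longrightarrow> qf N (z + e *\<^sub>R w) < 0"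
      using negative_near_zero[of "\<lambda>e. qf N (z + e *\<^sub>R w)"] z(2) by auto
    then obtain e :: real where e: "e > 0" "qf N (z + e *\<^sub>R w) < 0" using dense by blast
    have "bil L z w = 0" using True bil_commute[OF sym(1), of z w] by (simp add: bil_def)
    then have "qf L (z + e *\<^sub>R w) = 0" unfolding qf_add_scaleR[OF sym(1)] using z w by simp
    moreover have "L *v (z + e *\<^sub>R w) \<noteq> 0"
      using True Lw e by (simp add: matrix_vector_right_distrib matrix_vector_mult_scaleR)
    ultimately show ?thesis using that e by blast
  qed
qed

text \<open>Pairing a linear relation with \<open>w\<close>, which annihilates \<open>L x\<close>
  but not \<open>N x\<close>, isolates \<open>t\<close>.\<close>

lemma regular_zeroI:
  assumes sym: "transpose L = L" "transpose N = N" and "qf L x = 0" "qf N x = 0" "L *v x \<noteq> 0"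
    and w: "bil L x w = 0" "bil N x w \<noteq> 0"
  shows "regular_zero L N x"
  unfolding regular_zero_def
proof (intro conjI allI impI)
  fix s t assume st: "s *\<^sub>R (L *v x) + t *\<^sub>R (N *v x) = 0"
  have "w \<bullet> (s *\<^sub>R (L *v x) + t *\<^sub>R (N *v x)) = s * bil L w x + t * bil N w x"
    by (simp add: bil_def inner_right_distrib)
  then show t: "t = 0" using st w bil_commute[OF sym(1), of x w] bil_commute[OF sym(2), of x w] by simp
  show "s = 0" using st t assms by simp
qed fact+

text \<open>Moving along \<open>v\<close> changes neither \<open>qf L\<close> nor the vector
  \<open>L z\<close>. Starting from a zero of \<open>qf L\<close> where \<open>qf N\<close> has the
  sign opposite to \<open>qf N v\<close>, this line contains a simple zero of
  \<open>qf N\<close>.\<close>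

lemma regular_zero_from_kernel:
  assumes sym: "transpose L = L" "transpose N = N" and ip: "indefinite_pencil L N"
    and v: "L *v v = 0" "qf N v \<noteq> 0"
  shows "\<exists>x. regular_zero L N x"
proof -
  have *: "\<exists>x. regular_zero L N x"
    if sym: "transpose N = N" and ip: "indefinite_pencil L N" and v': "qf N v > 0" for N
  proof -
    obtain z where z: "qf L z = 0" "qf N z < 0" "L *v z \<noteq> 0"
      using zero_with_negative_value[OF assms(1) sym ip] .
    have "qf N v * qf N z < 0" using z v' by (simp add: mult_pos_neg)
    then obtain s where s: "qf N z + 2 * s * bil N z v + s\<^sup>2 * qf N v = 0" "bil N z v + s * qf N v \<noteq> 0"
      by (metis quadratic_roots_opposite_sign)
    have Lv: "bil L y v = 0" for y using v(1) by (simp add: bil_def)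
    have "regular_zero L N (z + s *\<^sub>R v)"
    proof (rule regular_zeroI[OF assms(1) sym])
      show "qf L (z + s *\<^sub>R v) = 0" unfolding qf_add_scaleR[OF assms(1)] using z Lv by simp
      show "qf N (z + s *\<^sub>R v) = 0" unfolding qf_add_scaleR[OF sym] by (rule s)
      show "L *v (z + s *\<^sub>R v) \<noteq> 0"
        using z v by (simp add: matrix_vector_right_distrib matrix_vector_mult_scaleR)
      show "bil L (z + s *\<^sub>R v) v = 0" by (rule Lv)
      show "bil N (z + s *\<^sub>R v) v \<noteq> 0" using s(2) by simp
    qed
    then show ?thesis by blast
  qed
  show ?thesis
  proof (cases "qf N v > 0")
    case True then show ?thesis using * sym ip by blast
  next
    case False
    then have "qf (- N) v > 0" using v(2) by simp
    then show ?thesis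
      using *[OF transpose_combination(2)[OF sym(2,2)] indefinite_pencil_minus[OF ip]] regular_zero_minus
      by blast
  qed
qed

text \<open>On a totally \<open>M\<close>-isotropic plane where \<open>N\<close> is indefinite, \<open>N\<close> has simple zeros. If no such
  plane through \<open>y\<close> exists, Finsler's lemma applies on the \<open>M\<close>-orthogonal complement of \<open>y\<close>.\<close>

lemma semidefinite_on_hyperplane:
  fixes M N :: "real^'n^'n"
  assumes sym: "transpose M = M" "transpose N = N" and ip: "indefinite_pencil M N"
    and none: "\<nexists>x. regular_zero M N x"
    and k: "pos_index_ge k M" "pos_index_ge k (- M)" "2 \<le> k"
  obtains t h where "\<And>z. h \<bullet> z = 0 \<Longrightarrow> 0 \<le> qf N z + t * qf M z"
proof -
  obtain y where y: "qf M y = 0" "qf (- N) y < 0" "M *v y \<noteq> 0"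
    using zero_with_negative_value[OF sym(1) transpose_combination(2)[OF sym(2,2)] indefinite_pencil_minus[OF ip]] .
  define H where "H = {z. \<forall>x\<in>{M *v y}. x \<bullet> z = 0}"
  have H: "subspace H" unfolding H_def by (rule subspace_orthogonal)
  have HI: "z \<in> H \<longleftrightarrow> bil M y z = 0" for z
    using bil_commute[OF sym(1), of y z] by (simp add: H_def bil_def inner_commute)
  have "CARD('n) \<le> dim H + 1" using dim_orthogonal_to_finite_ge[of "{M *v y}"] by (simp add: H_def)
  then have d: "CARD('n) < dim H + k" using k(3) by linarith
  obtain u v where u: "u \<in> H" "qf M u > 0" and v: "v \<in> H" "qf M v < 0"
    using pos_index_ge_meets[OF k(1) H d] pos_index_ge_meets[OF k(2) H d]
    by (metis bil_simps(14) neg_0_less_iff_less)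
  have "qf N z \<ge> 0" if z: "z \<in> H" "qf M z = 0" for z
  proof (rule ccontr)
    assume "\<not> qf N z \<ge> 0"
    then have "qf N z * qf N y < 0" using y by (simp add: mult_neg_pos)
    then obtain r s where rs: "r < 0" "0 < s"
      "qf N y + 2 * r * bil N y z + r\<^sup>2 * qf N z = 0" "qf N y + 2 * s * bil N y z + s\<^sup>2 * qf N z = 0"
      "bil N y z + r * qf N z \<noteq> 0" "bil N y z + s * qf N z \<noteq> 0"
      by (metis quadratic_roots_opposite_sign)
    \<comment> \<open>The plane of \<open>y\<close> and \<open>z\<close> is
      \<open>M\<close>-isotropic, so a simple zero of \<open>qf N\<close> on it is regular unless
      \<open>M\<close> kills it. With both zeros in the kernel of \<open>M\<close>, also
      \<open>M y = 0\<close>, contrary to the choice of \<open>y\<close>.\<close>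
    have ker: "M *v (y + c *\<^sub>R z) = 0"
      if c: "qf N y + 2 * c * bil N y z + c\<^sup>2 * qf N z = 0" "bil N y z + c * qf N z \<noteq> 0" for c
    proof (rule ccontr)
      assume nz: "M *v (y + c *\<^sub>R z) \<noteq> 0"
      have Myz: "bil M y z = 0" using z by (simp add: HI)
      have "regular_zero M N (y + c *\<^sub>R z)"
      proof (rule regular_zeroI[OF sym _ _ nz])
        show "qf M (y + c *\<^sub>R z) = 0" unfolding qf_add_scaleR[OF sym(1)] using y z Myz by simp
        show "qf N (y + c *\<^sub>R z) = 0" unfolding qf_add_scaleR[OF sym(2)] by (rule c)
        show "bil M (y + c *\<^sub>R z) z = 0" using z Myz by simp
        show "bil N (y + c *\<^sub>R z) z \<noteq> 0" using c(2) by simp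
      qed
      then show False using none by blast
    qed
    have r: "M *v y + r *\<^sub>R (M *v z) = 0" and s: "M *v y + s *\<^sub>R (M *v z) = 0"
      using ker[OF rs(3,5)] ker[OF rs(4,6)]
      by (simp_all add: matrix_vector_right_distrib matrix_vector_mult_scaleR)
    then have "(s - r) *\<^sub>R (M *v z) = 0" 
      unfolding scaleR_left_diff_distrib by (metis add_left_cancel right_minus_eq)
    then have "M *v z = 0" using rs by simp
    then show False using r y by simp
  qed
  then obtain t where "\<And>z. z \<in> H \<Longrightarrow> qf N z + t * qf M z \<ge> 0"
    using finsler[OF sym H u v] by blast
  then show ?thesis using that[of "M *v y" t] by (simp add: H_def)
qed

text \<open>Without a regular zero, \<open>N + t M\<close> and \<open>- N + t' M\<close> are
  nonnegative on two hyperplanes. Index 3 keeps \<open>qf M\<close> indefinite on their intersection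
  \<open>H\<close>, so \<open>t' = - t\<close> and \<open>N + t M\<close> vanishes on
  \<open>H\<close>. As \<open>H\<close> has codimension at most two, this form has rank at most
  4.\<close>

lemma regular_zero_balanced_signature:
  fixes M N :: "real^'n^'n"
  assumes sym: "transpose M = M" "transpose N = N" and ip: "indefinite_pencil M N"
    and k: "pos_index_ge 3 M" "pos_index_ge 3 (- M)"
    and r: "\<And>t. 5 \<le> rank (t *\<^sub>R M + 1 *\<^sub>R N)"
  shows "\<exists>x. regular_zero M N x"
proof (rule ccontr)
  assume none: "\<nexists>x. regular_zero M N x"
  then have none': "\<nexists>x. regular_zero M (- N) x" using regular_zero_minus by blast
  obtain t h where t: "\<And>z. h \<bullet> z = 0 \<Longrightarrow> 0 \<le> qf N z + t * qf M z"
    by (rule semidefinite_on_hyperplane[OF sym ip none k]) auto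
  obtain t' h' where t': "\<And>z. h' \<bullet> z = 0 \<Longrightarrow> 0 \<le> qf (- N) z + t' * qf M z"
    by (rule semidefinite_on_hyperplane[OF sym(1) transpose_combination(2)[OF sym(2,2)]
          indefinite_pencil_minus[OF ip] none' k]) auto
  define H where "H = {z. \<forall>x\<in>{h, h'}. x \<bullet> z = 0}"
  have H: "subspace H" unfolding H_def by (rule subspace_orthogonal)
  have "card {h, h'} \<le> 2" by (simp add: card_insert_if)
  then have d: "CARD('n) \<le> dim H + 2"
    using dim_orthogonal_to_finite_ge[of "{h, h'}"] by (simp add: H_def)
  then have d3: "CARD('n) < dim H + 3" by simp
  have sum: "0 \<le> (t + t') * qf M z" if "z \<in> H" for z
    using t[of z] t'[of z] that by (simp add: H_def algebra_simps)
  obtain u v where uv: "u \<in> H" "qf M u > 0" "v \<in> H" "qf M v < 0"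
    using pos_index_ge_meets[OF k(1) H d3] pos_index_ge_meets[OF k(2) H d3]
    by (metis bil_simps(14) neg_0_less_iff_less)
  have "t' = - t" using sum[OF uv(1)] sum[OF uv(3)] uv by (auto simp: zero_le_mult_iff)
  then have "qf (t *\<^sub>R M + 1 *\<^sub>R N) z = 0" if "z \<in> H" for z
    using t[of z] t'[of z] that by (simp add: H_def)
  from rank_isotropic_subspace[OF transpose_combination(1)[OF sym] H this] r[of t] d
  show False by linarith
qed

text \<open>Without a regular zero, every form of the pencil vanishes on the kernel of every nonzero one,
  so all ranks are at least half of the maximal rank.\<close>

lemma exists_regular_zero:
  fixes A B :: "real^'n^'n"
  assumes sym: "transpose A = A" "transpose B = B" and ip: "indefinite_pencil A B"
    and r: "9 \<le> rank (s0 *\<^sub>R A + t0 *\<^sub>R B)"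
  shows "\<exists>x. regular_zero A B x"
proof (rule ccontr)
  assume none: "\<nexists>x. regular_zero A B x"
  have symc: "transpose (a *\<^sub>R A + b *\<^sub>R B) = a *\<^sub>R A + b *\<^sub>R B" for a b
    using transpose_combination(1)[OF sym] .
  have none': "\<nexists>x. regular_zero (a *\<^sub>R A + b *\<^sub>R B) (- b *\<^sub>R A + a *\<^sub>R B) x" if "(a, b) \<noteq> (0, 0)" for a b
    using none regular_zero_basis_change that by blast
  have rank5: "5 \<le> rank (a *\<^sub>R A + b *\<^sub>R B)" if ab: "(a, b) \<noteq> (0, 0)" for a b
  proof -
    let ?L = "a *\<^sub>R A + b *\<^sub>R B" and ?N = "- b *\<^sub>R A + a *\<^sub>R B"
    have "qf (s0 *\<^sub>R A + t0 *\<^sub>R B) v = 0" if v: "v \<in> {v. ?L *v v = 0}" for v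
    proof -
      have N: "qf ?N v = 0"
        using regular_zero_from_kernel[OF symc symc indefinite_pencil_basis_change[OF ip ab]] none'[OF ab] v
        by blast
      have L: "qf ?L v = 0" using v by (simp only: bil_def) simp
      have "qf A v * a - (- qf B v) * b = 0" "qf A v * b + (- qf B v) * a = 0"
        using L N by (simp_all add: algebra_simps)
      from basis_change_nonzero[OF ab this] show ?thesis by simp
    qed
    moreover have "subspace {v. ?L *v v = 0}"
      by (auto simp: subspace_def matrix_vector_right_distrib matrix_vector_mult_scaleR)
    \<comment> \<open>With rank-nullity for \<open>?L\<close> this bounds the rank on the left,
      which is at least 9, by twice the rank of \<open>?L\<close>; hence that rank is at least
      5.\<close>
    ultimately have "rank (s0 *\<^sub>R A + t0 *\<^sub>R B) + 2 * dim {v. ?L *v v = 0} \<le> 2 * CARD('n)"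
      by (intro rank_isotropic_subspace symc)
    then show ?thesis using rank_nullity[of ?L] r by linarith
  qed
  \<comment> \<open>Rank 5 suffices for index 3 because \<open>2 * 3 \<le> 5 + 1\<close>.\<close>
  obtain z :: "real \<times> real" where z: "z \<noteq> 0" "pos_index_ge 3 (fst z *\<^sub>R A + snd z *\<^sub>R B)"
    "pos_index_ge 3 (- (fst z *\<^sub>R A + snd z *\<^sub>R B))"
    using pencil_balanced_signature(2)[OF sym, of 3] rank5 by fastforce
  have ab: "(fst z, snd z) \<noteq> (0, 0)" using z(1) by (simp add: zero_prod_def)
  have "5 \<le> rank (t *\<^sub>R (fst z *\<^sub>R A + snd z *\<^sub>R B) + 1 *\<^sub>R (- snd z *\<^sub>R A + fst z *\<^sub>R B))" for t
  proof -
    have "(t * fst z - 1 * snd z, t * snd z + 1 * fst z) \<noteq> (0, 0)"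
      using basis_change_nonzero[OF ab, of t 1] by auto
    then show ?thesis unfolding basis_change_entries by (rule rank5)
  qed
  then show False
    using regular_zero_balanced_signature[OF symc symc indefinite_pencil_basis_change[OF ip ab] z(2,3)]
      none'[OF ab] by blast
qed

section \<open>Forms vanishing on the common zeros\<close>

lemma quadratic_three_roots:
  fixes a b c :: real
  assumes "r1 \<noteq> r2" "r1 \<noteq> r3" "r2 \<noteq> r3"
    and "\<And>r. r \<in> {r1, r2, r3} \<Longrightarrow> c + 2 * r * b + r\<^sup>2 * a = 0"
  shows "c = 0" "a = 0"
proof -
  have e: "c + 2 * r1 * b + r1\<^sup>2 * a = 0" "c + 2 * r2 * b + r2\<^sup>2 * a = 0" "c + 2 * r3 * b + r3\<^sup>2 * a = 0"
    using assms(4) by auto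
  have "(r1 - r2) * (2 * b + (r1 + r2) * a) = 0" "(r1 - r3) * (2 * b + (r1 + r3) * a) = 0"
    using e by (simp_all add: algebra_simps power2_eq_square)
  then have b: "2 * b + (r1 + r2) * a = 0" "2 * b + (r1 + r3) * a = 0" using assms(1,2) by simp_all
  then have "(r2 - r3) * a = 0" by algebra
  then show "a = 0" using assms(3) by simp
  with b e show "c = 0" by simp
qed

lemma three_sign_changes:
  fixes f :: "real \<Rightarrow> real"
  assumes cont: "continuous_on UNIV f" and p: "p1 < p2" "p2 < p3" "p3 < p4"
    and f: "f p1 < 0" "f p2 > 0" "f p3 < 0" "f p4 > 0"
  obtains r1 r2 r3 where "r1 < r2" "r2 < r3" "f r1 = 0" "f r2 = 0" "f r3 = 0"
proof -
  have c: "continuous_on S f" for S using cont continuous_on_subset by blast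
  obtain r1 where r1: "p1 \<le> r1" "r1 \<le> p2" "f r1 = 0" using IVT'[of f p1 0 p2] c f p by force
  obtain r2 where r2: "p2 \<le> r2" "r2 \<le> p3" "f r2 = 0" using IVT2'[of f p3 0 p2] c f p by force
  obtain r3 where r3: "p3 \<le> r3" "r3 \<le> p4" "f r3 = 0" using IVT'[of f p3 0 p4] c f p by force
  have "r1 \<noteq> p2" "r2 \<noteq> p3" using r1 r2 f by auto
  then show ?thesis using that[of r1 r2 r3] r1 r2 r3 by linarith
qed

text \<open>The constant term dominates near 0 and the leading term far away, for both signs of
  \<open>s\<close>. The small radius is \<open>1 / D\<close>, where \<open>D\<close> is a large
  radius for the reversed polynomial with coefficients \<open>- c\<close> and
  \<open>- a\<close>.\<close>

lemma quadratic_sign_pattern: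
  fixes a b c :: real
  assumes "c < 0" "a > 0"
  obtains d R where "0 < d" "d < R"
    "\<And>s. \<bar>s\<bar> = d \<Longrightarrow> c + 2 * s * b + s\<^sup>2 * a < 0" "\<And>s. \<bar>s\<bar> = R \<Longrightarrow> c + 2 * s * b + s\<^sup>2 * a > 0"
proof -
  have large: "R > 1 \<and> R\<^sup>2 * a - 2 * R * \<bar>b\<bar> + c > 0"
    if "c < 0" "a > 0" "R = 1 + (2 * \<bar>b\<bar> - c) / a" for a c R :: real
  proof
    show "R > 1" using that by (simp add: divide_pos_pos)
    have "R * a = a + 2 * \<bar>b\<bar> - c" using that by (simp add: field_simps)
    then have "R\<^sup>2 * a = R * (a + 2 * \<bar>b\<bar> - c)" by (simp add: power2_eq_square mult.assoc)
    then have "R\<^sup>2 * a - 2 * R * \<bar>b\<bar> + c = R * a - (R - 1) * c" by (simp add: algebra_simps)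
    also have "\<dots> > 0"
    proof -
      have "(R - 1) * c < 0" using \<open>R > 1\<close> \<open>c < 0\<close> by (intro mult_pos_neg) simp_all
      moreover have "R * a > 0" using \<open>R > 1\<close> \<open>a > 0\<close> by (intro mult_pos_pos) simp_all
      ultimately show ?thesis by simp
    qed
    finally show "R\<^sup>2 * a - 2 * R * \<bar>b\<bar> + c > 0" .
  qed
  obtain R where R: "R > 1" "R\<^sup>2 * a - 2 * R * \<bar>b\<bar> + c > 0" using large[OF assms] by blast
  have "- a < 0" "- c > 0" using assms by simp_all
  then obtain D where D: "D > 1" "D\<^sup>2 * (- c) - 2 * D * \<bar>b\<bar> + (- a) > 0" using large by blast
  have bound: "2 * s * b \<le> 2 * r * \<bar>b\<bar>" "- (2 * r * \<bar>b\<bar>) \<le> 2 * s * b" "s\<^sup>2 = r\<^sup>2"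
    if "\<bar>s\<bar> = r" for s r
  proof -
    have "\<bar>s * b\<bar> = r * \<bar>b\<bar>" using that by (simp add: abs_mult)
    then show "2 * s * b \<le> 2 * r * \<bar>b\<bar>" "- (2 * r * \<bar>b\<bar>) \<le> 2 * s * b" by linarith+
    show "s\<^sup>2 = r\<^sup>2" using that by auto
  qed
  show ?thesis
  proof (rule that[of "1 / D" R])
    show "0 < 1 / D" using D(1) by simp
    have "1 / D < 1" using D(1) by simp
    then show "1 / D < R" using R(1) by linarith
    fix s :: real
    show "c + 2 * s * b + s\<^sup>2 * a > 0" if "\<bar>s\<bar> = R"
      unfolding bound(3)[OF that] using R(2) bound(1,2)[OF that] by linarith
    have "c + 2 * (1 / D) * \<bar>b\<bar> + (1 / D)\<^sup>2 * a = - (D\<^sup>2 * (- c) - 2 * D * \<bar>b\<bar> + (- a)) / D\<^sup>2"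
      using D(1) by (simp add: field_simps power2_eq_square)
    also have "\<dots> < 0" using D by (intro divide_neg_pos) simp_all
    finally show "c + 2 * s * b + s\<^sup>2 * a < 0" if "\<bar>s\<bar> = 1 / D"
      unfolding bound(3)[OF that] using bound(1,2)[OF that] by linarith
  qed
qed

lemma linear_surj_if_no_annihilator:
  fixes f :: "'a::euclidean_space \<Rightarrow> 'b::euclidean_space"
  assumes "linear f" "\<And>c. (\<forall>y. c \<bullet> f y = 0) \<Longrightarrow> c = 0"
  shows "surj f"
proof (rule ccontr)
  assume "\<not> surj f"
  moreover have "span (range f) = range f"
    using assms(1) by (simp add: linear_subspace_image subspace_UNIV span_eq_iff)
  ultimately have "dim (range f) < DIM('b)"
    by (metis dim_eq_full dim_subset_UNIV le_neq_implies_less)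
  then obtain c where "c \<noteq> 0" "\<And>y. y \<in> span (range f) \<Longrightarrow> orthogonal c y"
    using orthogonal_to_subspace_exists by blast
  then show False using assms(2)[of c] by (auto simp: orthogonal_def span_base)
qed

lemma regular_zero_prescribe:
  assumes sym: "transpose A = A" "transpose B = B" and x: "regular_zero A B x"
  obtains e where "bil A x e = p" "bil B x e = q"
proof -
  let ?f = "\<lambda>y. (bil A x y, bil B x y)"
  have "surj ?f"
  proof (rule linear_surj_if_no_annihilator)
    show "linear ?f" by (rule linearI) auto
    fix c :: "real \<times> real" assume c: "\<forall>y. c \<bullet> ?f y = 0"
    have "(fst c *\<^sub>R (A *v x) + snd c *\<^sub>R (B *v x)) \<bullet> y = c \<bullet> ?f y" for y
      by (simp add: inner_prod_def inner_left_distrib inner_mult_eq_bil sym)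
    then have "fst c *\<^sub>R (A *v x) + snd c *\<^sub>R (B *v x) = 0" using c by (metis inner_eq_zero_iff)
    then show "c = 0" using x unfolding regular_zero_def by (simp add: prod_eq_iff)
  qed
  then obtain e where "(p, q) = ?f e" by (rule surjE)
  then show ?thesis using that by simp
qed

lemma qf_has_derivative:
  fixes M :: "real^'n^'n"
  assumes "transpose M = M"
  shows "(qf M has_derivative (\<lambda>h. 2 * bil M x h)) (at x)"
proof -
  have "((*v) M has_derivative (*v) M) (at x)"
    by (simp add: bounded_linear_imp_has_derivative linear_conv_bounded_linear[symmetric])
  then have "((\<lambda>y. y \<bullet> (M *v y)) has_derivative (\<lambda>h. x \<bullet> (M *v h) + h \<bullet> (M *v x))) (at x)"
    by (intro has_derivative_inner has_derivative_ident)
  moreover have "x \<bullet> (M *v h) + h \<bullet> (M *v x) = 2 * bil M x h" for h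
    using bil_commute[OF assms, of x h] by (simp add: bil_def)
  ultimately show ?thesis by (simp add: bil_def)
qed

text \<open>If the three gradients at \<open>x\<close> were independent, \<open>(qf A, qf B, qf C)\<close> would be open at \<open>x\<close>
  and hence attain a value \<open>(0, 0, e)\<close> with \<open>e \<noteq> 0\<close>.\<close>

lemma gradient_dependence:
  fixes A B C :: "real^'n^'n"
  assumes sym: "transpose A = A" "transpose B = B" "transpose C = C" and x: "regular_zero A B x"
    and van: "\<And>z. qf A z = 0 \<Longrightarrow> qf B z = 0 \<Longrightarrow> qf C z = 0"
  obtains a b where "(C - (a *\<^sub>R A + b *\<^sub>R B)) *v x = 0"
proof -
  define F where "F = (\<lambda>z. (qf A z, qf B z, qf C z))"
  define F' where "F' = (\<lambda>h. (2 * bil A x h, 2 * bil B x h, 2 * bil C x h))"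
  have lin: "linear F'" unfolding F'_def by (rule linearI) (auto simp: algebra_simps)
  have der: "(F has_derivative F') (at x)"
    unfolding F_def F'_def by (intro has_derivative_Pair qf_has_derivative sym)
  have cont: "continuous_on UNIV F" unfolding F_def by (intro continuous_intros)
  have Fx: "F x = 0" using x van by (simp add: F_def regular_zero_def zero_prod_def)
  have "\<not> surj F'"
  proof
    assume "surj F'"
    then obtain g where g: "linear g" "F' \<circ> g = id"
      using linear_surjective_right_inverse[OF lin] by blast
    have "F x \<in> interior (F ` UNIV)"
      by (rule sussmann_open_mapping[OF open_UNIV cont UNIV_I der _ g(2)])
        (use g in \<open>simp_all add: linear_conv_bounded_linear\<close>)
    then obtain e where e: "e > 0" "ball 0 e \<subseteq> range F" by (auto simp: Fx mem_interior)
    have "(0, 0, e / 2) \<in> ball (0 :: real \<times> real \<times> real) e"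
      using e by (simp add: zero_prod_def dist_Pair_Pair dist_real_def)
    with e(2) have "(0, 0, e / 2) \<in> range F" by (rule subsetD)
    then obtain z where "F z = (0, 0, e / 2)" by (metis rangeE)
    then show False using van[of z] e by (simp add: F_def)
  qed
  then obtain c where c: "c \<noteq> 0" "\<forall>y. c \<bullet> F' y = 0"
    using linear_surj_if_no_annihilator[OF lin] by blast
  obtain \<alpha> \<beta> \<gamma> where abc: "c = (\<alpha>, \<beta>, \<gamma>)" by (cases c) auto
  let ?v = "\<alpha> *\<^sub>R (A *v x) + \<beta> *\<^sub>R (B *v x) + \<gamma> *\<^sub>R (C *v x)"
  have "?v \<bullet> y = (c \<bullet> F' y) / 2" for y
    by (simp add: abc F'_def inner_left_distrib inner_mult_eq_bil sym)
  then have v: "?v = 0" using c(2) by (metis div_0 inner_eq_zero_iff)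
  have "\<gamma> \<noteq> 0" using v x c(1) unfolding regular_zero_def abc by (auto simp: zero_prod_def)
  have "(C - ((- \<alpha> / \<gamma>) *\<^sub>R A + (- \<beta> / \<gamma>) *\<^sub>R B)) *v x = (1 / \<gamma>) *\<^sub>R ?v"
    using \<open>\<gamma> \<noteq> 0\<close>
    by (simp add: matrix_vector_mult_diff_rdistrib matrix_vector_mult_add_rdistrib
        scaleR_matrix_vector_assoc[symmetric] algebra_simps)
  also have "\<dots> = 0" using v by simp
  finally show ?thesis by (rule that)
qed

text \<open>Projecting the zero set from \<open>x\<close>, the form \<open>C\<close> vanishes on the real points of the cubic
  \<open>bil A x y * qf B y = bil B x y * qf A y\<close>. A whole open set of lines meets this cubic in three
  points, which forces the quadratic polynomial \<open>qf C\<close> to vanish along them.\<close>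

lemma vanishing_from_regular_zero:
  fixes A B C :: "real^'n^'n"
  assumes sym: "transpose A = A" "transpose B = B" "transpose C = C" and x: "regular_zero A B x"
    and van: "\<And>z. qf A z = 0 \<Longrightarrow> qf B z = 0 \<Longrightarrow> qf C z = 0" and Cx: "C *v x = 0"
    and v: "bil A x v = p" "bil B x v = q" and w: "bil A x w = 0" "bil B x w = 0"
    and neg: "p * qf B w - q * qf A w < 0" and pos: "p * qf B v - q * qf A v > 0"
  shows "C = 0"
proof -
  define f where "f y = bil A x y * qf B y - bil B x y * qf A y" for y
  have Cx': "bil C x y = 0" for y using Cx bil_commute[OF sym(3), of x y] by (simp add: bil_def)
  have on_cubic: "qf C y = 0" if fy: "f y = 0" and y: "(bil A x y, bil B x y) \<noteq> (0, 0)" for y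
  proof (cases "qf A y = 0 \<and> qf B y = 0")
    case True then show ?thesis using van by blast
  next
    case False
    \<comment> \<open>The line through \<open>x\<close> in direction \<open>y\<close> meets each
      quadric again where \<open>2 * bil M x y + t * qf M y = 0\<close>; the equation
      \<open>f y = 0\<close> says that one \<open>t\<close> serves both.\<close>
    obtain t where t: "2 * bil A x y + t * qf A y = 0" "2 * bil B x y + t * qf B y = 0"
    proof (cases "qf A y = 0")
      case True
      then have "qf B y \<noteq> 0" "bil A x y = 0" using False fy by (auto simp: f_def)
      then show ?thesis using that[of "- 2 * bil B x y / qf B y"] True by simp
    next
      case False
      then show ?thesis using that[of "- 2 * bil A x y / qf A y"] fy by (simp add: f_def field_simps)
    qed
    have tn: "t \<noteq> 0" using t y by auto
    have quad: "qf M (x + t *\<^sub>R y) = qf M x + t * (2 * bil M x y + t * qf M y)" if "transpose M = M" for M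
      unfolding qf_add_scaleR[OF that] by (simp add: algebra_simps power2_eq_square)
    have "qf C (x + t *\<^sub>R y) = 0"
      using x t by (intro van) (simp_all add: quad[OF sym(1)] quad[OF sym(2)] regular_zero_def del: bil_simps)
    then have "qf C x + t * (2 * bil C x y + t * qf C y) = 0" using quad[OF sym(3)] by metis
    then show ?thesis using Cx' tn by simp
  qed
  \<comment> \<open>On the line \<open>w + s v\<close> the pair of gradients takes the value
    \<open>s (p, q)\<close>, so the cubic factors as \<open>s * m\<close>. The quadratic
    \<open>m\<close> is negative for small and positive for large absolute values of
    \<open>s\<close>, and the factor \<open>s\<close> then produces three sign changes.\<close>
  define m where "m y = p * qf B y - q * qf A y" for y
  have m: "m (w + s *\<^sub>R v) = m w + 2 * s * (p * bil B w v - q * bil A w v) + s\<^sup>2 * m v" for s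
    unfolding m_def qf_add_scaleR[OF sym(1)] qf_add_scaleR[OF sym(2)] by (simp add: algebra_simps)
  have fm: "f (w + s *\<^sub>R v) = s * m (w + s *\<^sub>R v)" for s
  proof -
    have "bil A x (w + s *\<^sub>R v) = s * p" "bil B x (w + s *\<^sub>R v) = s * q" using v w by simp_all
    then show ?thesis unfolding f_def m_def by (simp add: algebra_simps)
  qed
  obtain d R where dR: "0 < d" "d < R" "\<And>s. \<bar>s\<bar> = d \<Longrightarrow> m (w + s *\<^sub>R v) < 0"
    "\<And>s. \<bar>s\<bar> = R \<Longrightarrow> m (w + s *\<^sub>R v) > 0"
    using quadratic_sign_pattern[of "m w" "m v" "p * bil B w v - q * bil A w v"] neg pos
    unfolding m by (fold m_def) metis
  have signs: "f (w + (- R) *\<^sub>R v) < 0" "f (w + (- d) *\<^sub>R v) > 0" "f (w + d *\<^sub>R v) < 0" "f (w + R *\<^sub>R v) > 0"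
    unfolding fm using dR(1,2) dR(3)[of d] dR(3)[of "- d"] dR(4)[of R] dR(4)[of "- R"]
    by (simp_all add: mult_pos_neg)
  \<comment> \<open>The root at \<open>s = 0\<close> lies where both gradient pairings vanish and
    \<open>on_cubic\<close> says nothing. A small shift by \<open>h e\<close> preserves the sign
    pattern and, by the choice of \<open>e\<close>, makes the line avoid such points. Three roots in
    \<open>s\<close> give \<open>qf C (w + h e) = 0\<close>, and three values of \<open>h\<close>
    then give \<open>qf C e = 0\<close>.\<close>
  have generic: "qf C e = 0" if e: "p * bil B x e \<noteq> q * bil A x e" for e
  proof -
    have cont: "continuous_on UNIV (\<lambda>h. f (w + h *\<^sub>R e + s *\<^sub>R v))" for s
      unfolding f_def by (intro continuous_intros)
    have cont': "continuous_on UNIV (\<lambda>h. - f (w + h *\<^sub>R e + s *\<^sub>R v))" for s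
      by (intro continuous_intros cont)
    obtain d1 where d1: "d1 > 0" "\<forall>h. 0 < h \<and> h < d1 \<longrightarrow> f (w + h *\<^sub>R e + (- R) *\<^sub>R v) < 0"
      by (rule negative_near_zero[OF cont[of "- R"]]) (use signs in auto)
    obtain d2 where d2: "d2 > 0" "\<forall>h. 0 < h \<and> h < d2 \<longrightarrow> - f (w + h *\<^sub>R e + (- d) *\<^sub>R v) < 0"
      by (rule negative_near_zero[OF cont'[of "- d"]]) (use signs in auto)
    obtain d3 where d3: "d3 > 0" "\<forall>h. 0 < h \<and> h < d3 \<longrightarrow> f (w + h *\<^sub>R e + d *\<^sub>R v) < 0"
      by (rule negative_near_zero[OF cont[of d]]) (use signs in auto)
    obtain d4 where d4: "d4 > 0" "\<forall>h. 0 < h \<and> h < d4 \<longrightarrow> - f (w + h *\<^sub>R e + R *\<^sub>R v) < 0"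
      by (rule negative_near_zero[OF cont'[of R]]) (use signs in auto)
    define D where "D = Min {d1, d2, d3, d4}"
    have D: "D > 0" "D \<le> d1" "D \<le> d2" "D \<le> d3" "D \<le> d4" using d1 d2 d3 d4 by (auto simp: D_def)
    have zero: "qf C (w + h *\<^sub>R e) = 0" if h: "0 < h" "h < D" for h
    proof -
      have "continuous_on UNIV (\<lambda>s. f (w + h *\<^sub>R e + s *\<^sub>R v))"
        unfolding f_def by (intro continuous_intros)
      then obtain r1 r2 r3 where r: "r1 < r2" "r2 < r3" "f (w + h *\<^sub>R e + r1 *\<^sub>R v) = 0"
        "f (w + h *\<^sub>R e + r2 *\<^sub>R v) = 0" "f (w + h *\<^sub>R e + r3 *\<^sub>R v) = 0"
        by (rule three_sign_changes[of _ "- R" "- d" d R]) (use dR D d1 d2 d3 d4 h in auto)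
      have off: "(bil A x (w + h *\<^sub>R e + s *\<^sub>R v), bil B x (w + h *\<^sub>R e + s *\<^sub>R v)) \<noteq> (0, 0)" for s
      proof
        assume "(bil A x (w + h *\<^sub>R e + s *\<^sub>R v), bil B x (w + h *\<^sub>R e + s *\<^sub>R v)) = (0, 0)"
        then have "h * bil A x e + s * p = 0" "h * bil B x e + s * q = 0" using v w by simp_all
        then have "h * (p * bil B x e - q * bil A x e) = 0" by algebra
        then show False using e h by simp
      qed
      show ?thesis
      proof (rule quadratic_three_roots(1))
        show "r1 \<noteq> r2" "r1 \<noteq> r3" "r2 \<noteq> r3" using r by auto
        fix s assume "s \<in> {r1, r2, r3}"
        then have "f (w + h *\<^sub>R e + s *\<^sub>R v) = 0" using r by blast
        from on_cubic[OF this off]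
        show "qf C (w + h *\<^sub>R e) + 2 * s * bil C (w + h *\<^sub>R e) v + s\<^sup>2 * qf C v = 0"
          unfolding qf_add_scaleR[OF sym(3), of "w + h *\<^sub>R e" s v] .
      qed
    qed
    show ?thesis
    proof (rule quadratic_three_roots(2))
      show "D/2 \<noteq> D/3" "D/2 \<noteq> D/4" "D/3 \<noteq> D/4" using D(1) by auto
      fix h assume "h \<in> {D/2, D/3, D/4}"
      then have "0 < h" "h < D" using D(1) by auto
      from zero[OF this] show "qf C w + 2 * h * bil C w e + h\<^sup>2 * qf C e = 0"
        unfolding qf_add_scaleR[OF sym(3), of w h e] .
    qed
  qed
  \<comment> \<open>The direction \<open>e0\<close> satisfies the genericity condition with value
    \<open>p * p + q * q\<close>; any exceptional \<open>e\<close> is reached from generic points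
    \<open>e + t e0\<close>.\<close>
  have "(p, q) \<noteq> (0, 0)" using neg by auto
  moreover obtain e0 where e0: "bil A x e0 = - q" "bil B x e0 = p" using regular_zero_prescribe[OF sym(1,2) x] .
  ultimately have nz: "p * bil B x e0 - q * bil A x e0 \<noteq> 0"
    by (simp add: sum_squares_eq_zero_iff)
  have "qf C e = 0" for e
  proof (cases "p * bil B x e = q * bil A x e")
    case False then show ?thesis by (rule generic)
  next
    case True
    show ?thesis
    proof (rule quadratic_three_roots(1))
      show "(1::real) \<noteq> 2" "(1::real) \<noteq> 3" "(2::real) \<noteq> 3" by simp_all
      fix t :: real assume t: "t \<in> {1, 2, 3}"
      have "p * bil B x (e + t *\<^sub>R e0) - q * bil A x (e + t *\<^sub>R e0) = t * (p * bil B x e0 - q * bil A x e0)"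
        using True by (simp add: algebra_simps)
      also have "\<dots> \<noteq> 0" using nz t by auto
      finally have "p * bil B x (e + t *\<^sub>R e0) \<noteq> q * bil A x (e + t *\<^sub>R e0)" by linarith
      from generic[OF this] show "qf C e + 2 * t * bil C e e0 + t\<^sup>2 * qf C e0 = 0"
        unfolding qf_add_scaleR[OF sym(3)] .
    qed
  qed
  then show ?thesis using matrix_eq_0_iff_qf[OF sym(3)] by blast
qed

text \<open>After subtracting a pencil element, \<open>C' x = 0\<close>. It remains to find
  \<open>v\<close> and \<open>w\<close> for the cubic argument: with \<open>p = t\<close> and
  \<open>q = - s\<close> its two sign conditions say that \<open>s A + t B\<close> is negative at a
  tangent vector \<open>w\<close> and positive at \<open>v\<close>.\<close>

lemma vanishing_form_in_pencil:
  fixes A B C :: "real^'n^'n"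
  assumes sym: "transpose A = A" "transpose B = B" "transpose C = C" and x: "regular_zero A B x"
    and van: "\<And>z. qf A z = 0 \<Longrightarrow> qf B z = 0 \<Longrightarrow> qf C z = 0"
    and r3: "\<And>s t. (s, t) \<noteq> (0, 0) \<Longrightarrow> 3 \<le> rank (s *\<^sub>R A + t *\<^sub>R B)"
    and r5: "5 \<le> rank (s0 *\<^sub>R A + t0 *\<^sub>R B)"
  shows "\<exists>a b. C = a *\<^sub>R A + b *\<^sub>R B"
proof -
  obtain a b where ab: "(C - (a *\<^sub>R A + b *\<^sub>R B)) *v x = 0"
    using gradient_dependence[OF sym x] van by blast
  define C' where "C' = C - (a *\<^sub>R A + b *\<^sub>R B)"
  have C': "transpose C' = C'" "C' *v x = 0" "\<And>z. qf A z = 0 \<Longrightarrow> qf B z = 0 \<Longrightarrow> qf C' z = 0"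
    using sym ab van by (simp_all add: C'_def transpose_def vec_eq_iff)
  define W where "W = {y. \<forall>u\<in>{A *v x, B *v x}. u \<bullet> y = 0}"
  have W: "subspace W" unfolding W_def by (rule subspace_orthogonal)
  note grad = inner_mult_eq_bil[OF sym(1)] inner_mult_eq_bil[OF sym(2)]
  have WI: "y \<in> W \<longleftrightarrow> bil A x y = 0 \<and> bil B x y = 0" for y by (simp add: W_def grad)
  have "card {A *v x, B *v x} \<le> 2" by (simp add: card_insert_if)
  then have dW: "CARD('n) \<le> dim W + 2"
    using dim_orthogonal_to_finite_ge[of "{A *v x, B *v x}"] by (simp add: W_def)
  define G where "G = {z::real\<times>real. pos_index_ge 2 (fst z *\<^sub>R A + snd z *\<^sub>R B) \<and>
                               pos_index_ge 2 (- (fst z *\<^sub>R A + snd z *\<^sub>R B))}"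
  have G: "open G" "G - {0} \<noteq> {}"
    using pencil_balanced_signature[OF sym(1,2), of 2] r3 unfolding G_def by auto
  have Gneg: "- z \<in> G" if "z \<in> G" for z
  proof -
    have "fst (- z) *\<^sub>R A + snd (- z) *\<^sub>R B = - (fst z *\<^sub>R A + snd z *\<^sub>R B)" by simp
    then show ?thesis using that unfolding G_def mem_Collect_eq by (metis minus_minus)
  qed
  \<comment> \<open>Were every form in the open set \<open>G\<close> zero on \<open>W\<close>,
    varying the coefficients would make \<open>qf A\<close> and \<open>qf B\<close> vanish on
    \<open>W\<close>. As \<open>W\<close> has codimension at most two, all ranks in the pencil would
    be at most 4.\<close>
  have "\<exists>z w. z \<in> G \<and> w \<in> W \<and> qf (fst z *\<^sub>R A + snd z *\<^sub>R B) w \<noteq> 0"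
  proof (rule ccontr)
    assume no: "\<not> ?thesis"
    obtain z where "z \<in> G" using G by blast
    then obtain e where e: "e > 0" "\<And>y. dist y z < e \<Longrightarrow> y \<in> G" using G(1) unfolding open_dist by blast
    have "(fst z + e/2, snd z) \<in> G" "(fst z, snd z + e/2) \<in> G"
      using e(1) by (auto intro!: e(2) simp: dist_prod_def dist_real_def)
    then have "qf A w = 0 \<and> qf B w = 0" if "w \<in> W" for w
    proof -
      have z0: "fst z * qf A w + snd z * qf B w = 0"
        "(fst z + e/2) * qf A w + snd z * qf B w = 0" "fst z * qf A w + (snd z + e/2) * qf B w = 0"
        using no that \<open>z \<in> G\<close> \<open>(fst z + e/2, snd z) \<in> G\<close> \<open>(fst z, snd z + e/2) \<in> G\<close> by force+
      then have "e/2 * qf A w = 0" "e/2 * qf B w = 0" by algebra+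
      then show ?thesis using e(1) by simp
    qed
    then have "rank (s0 *\<^sub>R A + t0 *\<^sub>R B) + 2 * dim W \<le> 2 * CARD('n)"
      by (intro rank_isotropic_subspace[OF transpose_combination(1)[OF sym(1,2)] W]) simp
    then show False using dW r5 by linarith
  qed
  then obtain z w where zw: "z \<in> G" "w \<in> W" "qf (fst z *\<^sub>R A + snd z *\<^sub>R B) w \<noteq> 0" by blast
  have "\<exists>z. z \<in> G \<and> qf (fst z *\<^sub>R A + snd z *\<^sub>R B) w < 0"
  proof (cases "qf (fst z *\<^sub>R A + snd z *\<^sub>R B) w < 0")
    case True then show ?thesis using zw by blast
  next
    case False
    then have "qf (fst (- z) *\<^sub>R A + snd (- z) *\<^sub>R B) w < 0" using zw(3) by simp
    then show ?thesis using Gneg[OF zw(1)] by blast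
  qed
  then obtain s t where st: "(s, t) \<in> G" "qf (s *\<^sub>R A + t *\<^sub>R B) w < 0" by fastforce
  let ?M = "s *\<^sub>R A + t *\<^sub>R B"
  \<comment> \<open>On \<open>H\<close> the pair of gradient pairings is a multiple of
    \<open>(t, - s)\<close>; index 2 provides a positive vector in this hyperplane.\<close>
  define H where "H = {y. \<forall>u\<in>{s *\<^sub>R (A *v x) + t *\<^sub>R (B *v x)}. u \<bullet> y = 0}"
  have HI: "y \<in> H \<longleftrightarrow> s * bil A x y + t * bil B x y = 0" for y
    by (simp add: H_def inner_left_distrib grad)
  have H: "subspace H" unfolding H_def by (rule subspace_orthogonal)
  have "CARD('n) < dim H + 2"
    using dim_orthogonal_to_finite_ge[of "{s *\<^sub>R (A *v x) + t *\<^sub>R (B *v x)}"] by (simp add: H_def)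
  moreover have "pos_index_ge 2 ?M" using st(1) by (simp add: G_def)
  ultimately obtain y where y: "y \<in> H" "qf ?M y > 0" using pos_index_ge_meets H by blast
  have stn: "(s, t) \<noteq> (0, 0)" using st(2) by auto
  obtain v where v: "bil A x v = t" "bil B x v = - s" "qf ?M v > 0"
  proof -
    \<comment> \<open>The multiple \<open>\<rho>\<close> may be 0. A small shift \<open>h e\<close>
      turns it into a nonzero \<open>\<rho> + h\<close> while preserving positivity, and rescaling
      gives \<open>v\<close>.\<close>
    obtain \<rho> where \<rho>: "bil A x y = \<rho> * t" "bil B x y = - \<rho> * s"
    proof (cases "s = 0")
      case True
      then have "t \<noteq> 0" using stn by simp
      moreover have "bil B x y = 0" using y(1) True \<open>t \<noteq> 0\<close> by (simp add: HI)
      ultimately show ?thesis using that[of "bil A x y / t"] True by simp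
    next
      case False
      then show ?thesis using that[of "- bil B x y / s"] y(1) by (simp add: HI field_simps)
    qed
    obtain e where e: "bil A x e = t" "bil B x e = - s" using regular_zero_prescribe[OF sym(1,2) x] .
    have "continuous_on UNIV (\<lambda>h. - qf ?M (y + h *\<^sub>R e))" by (intro continuous_intros)
    then obtain d :: real where d: "d > 0" "\<forall>h. 0 < h \<and> h < d \<longrightarrow> - qf ?M (y + h *\<^sub>R e) < 0"
      by (rule negative_near_zero) (use y in auto)
    obtain h where h: "0 < h" "h < d" "h \<noteq> - \<rho>"
    proof (cases "d / 2 = - \<rho>")
      case True then show ?thesis using that[of "d / 3"] d(1) by simp
    next
      case False then show ?thesis using that[of "d / 2"] d(1) by simp
    qed
    then have pos: "qf ?M (y + h *\<^sub>R e) > 0" and n: "\<rho> + h \<noteq> 0" using d by auto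
    let ?v = "(1 / (\<rho> + h)) *\<^sub>R (y + h *\<^sub>R e)"
    have "bil A x (y + h *\<^sub>R e) = (\<rho> + h) * t" "bil B x (y + h *\<^sub>R e) = (\<rho> + h) * (- s)"
      using \<rho> e by (simp_all add: algebra_simps)
    then have "bil A x ?v = t" "bil B x ?v = - s" using n by (simp_all only: bil_simps(8)) simp_all
    moreover have "qf ?M ?v > 0"
    proof -
      have "qf ?M ?v = (1 / (\<rho> + h))\<^sup>2 * qf ?M (y + h *\<^sub>R e)"
        by (simp only: bil_simps(3,8) power2_eq_square mult.assoc)
      then show ?thesis using pos n by (metis divide_eq_0_iff mult_pos_pos one_neq_zero zero_less_power2)
    qed
    ultimately show ?thesis by (rule that)
  qed
  have "C' = 0"
    by (rule vanishing_from_regular_zero[OF sym(1,2) C'(1) x C'(3,2) v(1,2)])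
      (use zw(2) st(2) v(3) in \<open>auto simp: WI\<close>)
  then show ?thesis by (auto simp: C'_def)
qed

section \<open>Pencils containing a form of rank two\<close>

text \<open>Diagonalising with two vectors exhausts the rank. Indefiniteness makes the two squares
  enter with opposite signs, and a difference of squares factors.\<close>

lemma rank_two_indefinite_factors:
  fixes L :: "real^'n^'n"
  assumes sym: "transpose L = L" and r: "rank L = 2" and uv: "qf L u > 0" "qf L v < 0"
  obtains a b where "\<And>z. qf L z = (a \<bullet> z) * (b \<bullet> z)"
proof -
  obtain X where X: "orthogonal_system L X" "card X = 2"
    using exists_orthogonal_system[OF sym] r by (metis order_refl)
  then obtain x y where xy: "X = {x, y}" "x \<noteq> y" by (auto simp: card_2_iff)
  have nz: "qf L x \<noteq> 0" "qf L y \<noteq> 0" and o: "bil L x y = 0" "bil L y x = 0"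
    using X xy by (auto simp: orthogonal_system_def)
  have iso: "qf L w = 0" if w: "\<forall>x\<in>X. bil L x w = 0" for w
  proof (rule ccontr)
    assume nw: "qf L w \<noteq> 0"
    have "bil L w x = 0" if "x \<in> X" for x using w that bil_commute[OF sym] by metis
    then have "orthogonal_system L (insert w X)"
      using X(1) w nw by (auto simp: orthogonal_system_def)
    moreover have "card (insert w X) = 3"
      using w nw X by (subst card_insert_disjoint) (auto simp: orthogonal_system_def)
    ultimately show False using orthogonal_system_card_le_rank[of L "insert w X"] r by simp
  qed
  have diag: "qf L z = (bil L x z)\<^sup>2 / qf L x + (bil L y z)\<^sup>2 / qf L y" for z
  proof -
    define p where "p = (bil L x z / qf L x) *\<^sub>R x + (bil L y z / qf L y) *\<^sub>R y"
    have "\<forall>u\<in>X. bil L u (z - p) = 0" using nz o by (simp add: xy p_def)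
    with iso have k: "L *v (z - p) = 0"
      by (rule orthogonal_system_remainder_kernel[OF sym X(1)])
    have e: "bil L u (z - p) = 0" for u using k by (simp add: bil_def)
    have "qf L z = bil L z p" using e[of z] by simp
    also have "\<dots> = bil L p z" by (rule bil_commute[OF sym])
    also have "\<dots> = (bil L x z)\<^sup>2 / qf L x + (bil L y z)\<^sup>2 / qf L y"
      by (simp add: p_def power2_eq_square)
    finally show ?thesis .
  qed
  have factors: "\<exists>a b. \<forall>z. qf L z = (a \<bullet> z) * (b \<bullet> z)"
    if pn: "qf L p > 0" "qf L n < 0"
      and d: "\<And>z. qf L z = (bil L p z)\<^sup>2 / qf L p + (bil L n z)\<^sup>2 / qf L n" for p n
  proof -
    define g where "g = (1 / sqrt (qf L p)) *\<^sub>R (L *v p)"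
    define h where "h = (1 / sqrt (- qf L n)) *\<^sub>R (L *v n)"
    have "(g \<bullet> z)\<^sup>2 = (bil L p z)\<^sup>2 / qf L p" "(h \<bullet> z)\<^sup>2 = - ((bil L n z)\<^sup>2 / qf L n)" for z
      using pn by (simp_all add: g_def h_def inner_mult_eq_bil[OF sym] power_mult_distrib power_divide)
    then have "qf L z = ((g + h) \<bullet> z) * ((g - h) \<bullet> z)" for z
      using d[of z] by (simp add: inner_left_distrib inner_diff_left square_diff_square_factored[symmetric] power2_eq_square algebra_simps)
    then show ?thesis by blast
  qed
  have "\<not> (qf L x > 0 \<and> qf L y > 0)"
  proof
    assume "qf L x > 0 \<and> qf L y > 0"
    then have "qf L v \<ge> 0" unfolding diag[of v] by simp
    then show False using uv by simp
  qed
  moreover have "\<not> (qf L x < 0 \<and> qf L y < 0)"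
  proof
    assume "qf L x < 0 \<and> qf L y < 0"
    then have "qf L u \<le> 0" unfolding diag[of u]
      by (intro add_nonpos_nonpos divide_nonneg_neg) simp_all
    then show False using uv by simp
  qed
  ultimately consider "qf L x > 0" "qf L y < 0" | "qf L y > 0" "qf L x < 0" using nz by linarith
  then have "\<exists>a b. \<forall>z. qf L z = (a \<bullet> z) * (b \<bullet> z)"
  proof cases
    case 1 then show ?thesis by (rule factors) (rule diag)
  next
    case 2
    have "qf L z = (bil L y z)\<^sup>2 / qf L y + (bil L x z)\<^sup>2 / qf L x" for z
      using diag[of z] by simp
    with 2 show ?thesis by (rule factors)
  qed
  then show ?thesis using that by blast
qed

lemma proportional_to_inner:
  fixes f :: "'a::euclidean_space \<Rightarrow> real"
  assumes "linear f" "a \<bullet> e \<noteq> 0" "\<And>z. a \<bullet> z = 0 \<Longrightarrow> f z = 0"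
  obtains \<mu> where "\<And>z. f z = \<mu> * (a \<bullet> z)"
proof -
  have "f z = f e / (a \<bullet> e) * (a \<bullet> z)" for z
  proof -
    have "f (z - ((a \<bullet> z) / (a \<bullet> e)) *\<^sub>R e) = 0"
      using assms(2) by (intro assms(3)) (simp add: inner_diff_right)
    then show ?thesis using assms(1) by (simp add: linear_diff linear_scale)
  qed
  then show ?thesis using that by blast
qed

lemma independent_pair_dual:
  fixes a b :: "'a::euclidean_space"
  assumes "\<And>s t. s *\<^sub>R a + t *\<^sub>R b = 0 \<Longrightarrow> s = 0 \<and> t = 0"
  obtains e where "a \<bullet> e \<noteq> 0" "b \<bullet> e = 0"
proof -
  \<comment> \<open>This is \<open>b \<bullet> b\<close> times the component of \<open>a\<close>
    orthogonal to \<open>b\<close>.\<close>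
  define e where "e = (b \<bullet> b) *\<^sub>R a - (a \<bullet> b) *\<^sub>R b"
  have b: "b \<bullet> b \<noteq> 0" using assms[of 0 1] by auto
  have be: "b \<bullet> e = 0" by (simp add: e_def inner_diff_right inner_commute)
  have "e \<noteq> 0" using assms[of "b \<bullet> b" "- (a \<bullet> b)"] b by (auto simp: e_def)
  moreover have "e \<bullet> e = (b \<bullet> b) * (a \<bullet> e)"
    using be by (subst (1) e_def) (simp add: inner_diff_left)
  ultimately have "a \<bullet> e \<noteq> 0" by auto
  with be show ?thesis using that by blast
qed

text \<open>On the hyperplane of \<open>a2\<close>, \<open>qf C\<close> is a multiple of
  \<open>qf B\<close>, and the point \<open>n\<close> shows that the multiple is 0. There the
  product of the linear forms \<open>a1\<close> and \<open>bil B b2\<close> vanishes while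
  \<open>a1\<close> does not, so the second factor vanishes.\<close>

lemma eigen_relation_if_indefinite:
  fixes B C :: "real^'n^'n"
  assumes sym: "transpose B = B" "transpose C = C"
    and C: "\<And>z. qf C z = (a1 \<bullet> z) * bil B b2 z + (a2 \<bullet> z) * bil B b1 z"
    and van: "\<And>z. (a1 \<bullet> z) * (a2 \<bullet> z) = 0 \<Longrightarrow> qf B z = 0 \<Longrightarrow> qf C z = 0"
    and ind: "\<And>s t. s *\<^sub>R a1 + t *\<^sub>R a2 = 0 \<Longrightarrow> s = 0 \<and> t = 0"
    and nz: "a1 \<bullet> n = 0" "a2 \<bullet> n = 0" "qf B n \<noteq> 0"
    and u: "a2 \<bullet> u = 0" "qf B u > 0" and v: "a2 \<bullet> v = 0" "qf B v < 0"
  obtains \<mu> where "\<And>z. bil B b2 z = \<mu> * (a2 \<bullet> z)"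
proof -
  define H where "H = {z. \<forall>x\<in>{a2}. x \<bullet> z = 0}"
  have H: "subspace H" unfolding H_def by (rule subspace_orthogonal)
  have HI: "z \<in> H \<longleftrightarrow> a2 \<bullet> z = 0" for z by (simp add: H_def)
  obtain t where t: "\<And>z. z \<in> H \<Longrightarrow> qf C z = t * qf B z"
    by (rule proportional_on_indefinite[OF sym H, of u v]) (use u v van in \<open>auto simp: HI\<close>)
  have "qf C n = 0" using nz by (simp add: C)
  then have "t = 0" using t[of n] nz by (simp add: HI)
  then have prod: "(a1 \<bullet> z) * bil B b2 z = 0" if "a2 \<bullet> z = 0" for z
    using t[of z] that C[of z] by (simp add: HI)
  obtain e where e: "a1 \<bullet> e \<noteq> 0" "a2 \<bullet> e = 0" using independent_pair_dual[of a1 a2] ind by blast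
  have Be: "bil B b2 e = 0" using prod[OF e(2)] e(1) by simp
  have zero: "bil B b2 z = 0" if z: "a2 \<bullet> z = 0" for z
  proof (cases "a1 \<bullet> z = 0")
    case False then show ?thesis using prod[OF z] by simp
  next
    case True
    have "a2 \<bullet> (z + e) = 0" using z e by (simp add: inner_right_distrib)
    from prod[OF this] show ?thesis using True e(1) Be by (simp add: inner_right_distrib)
  qed
  have "a2 \<bullet> a2 \<noteq> 0" using ind[of 0 1] by auto
  moreover have "linear (bil B b2)" by (rule linearI) auto
  ultimately obtain \<mu> where "\<And>z. bil B b2 z = \<mu> * (a2 \<bullet> z)"
    using proportional_to_inner[of "bil B b2" a2 a2] zero by blast
  then show ?thesis by (rule that)
qed

text \<open>With \<open>b2\<close> a multiple of the symplectic gradient of \<open>a2\<close>, the conclusion puts that vector into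
  \<open>ker A \<inter> ker B\<close>, to which it is \<open>sigma\<close>-orthogonal.\<close>

lemma common_kernel_if_semidefinite:
  fixes L B C :: "real^'n^'n"
  assumes sym: "transpose L = L" "transpose B = B" "transpose C = C" and ip: "indefinite_pencil L B"
    and L: "\<And>z. qf L z = (a1 \<bullet> z) * (a2 \<bullet> z)"
    and C: "\<And>z. qf C z = (a1 \<bullet> z) * bil B b2 z + (a2 \<bullet> z) * bil B b1 z"
    and van: "\<And>z. (a1 \<bullet> z) * (a2 \<bullet> z) = 0 \<Longrightarrow> qf B z = 0 \<Longrightarrow> qf C z = 0"
    and ind: "\<And>s t. s *\<^sub>R a1 + t *\<^sub>R a2 = 0 \<Longrightarrow> s = 0 \<and> t = 0"
    and nz: "a1 \<bullet> n = 0" "a2 \<bullet> n = 0" "qf B n \<noteq> 0"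
    and ab: "a2 \<bullet> b2 = 0"
    and semi: "\<And>z. a1 \<bullet> z = 0 \<Longrightarrow> 0 \<le> qf B z"
  shows "a1 \<bullet> b2 = 0 \<and> B *v b2 = 0"
proof -
  \<comment> \<open>Since \<open>qf B\<close> is nonnegative on the hyperplane of \<open>a1\<close>,
    this zero of \<open>qf L\<close> lies on that of \<open>a2\<close>; together with
    \<open>n\<close> it makes \<open>qf B\<close> indefinite there.\<close>
  obtain z where z: "qf L z = 0" "qf B z < 0" using zero_with_negative_value[OF sym(1,2) ip] by blast
  then have z2: "a2 \<bullet> z = 0" using L[of z] semi[of z] by auto
  have n: "qf B n > 0" using semi[OF nz(1)] nz(3) by simp
  obtain \<mu> where \<mu>: "\<And>z. bil B b2 z = \<mu> * (a2 \<bullet> z)"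
    using eigen_relation_if_indefinite[OF sym(2,3) C van ind nz nz(2) n z2 z(2)] by blast
  have b0: "qf B b2 = 0" using \<mu>[of b2] ab by simp
  \<comment> \<open>Otherwise \<open>z\<close> could be slid along \<open>b2\<close> into the
    hyperplane of \<open>a1\<close> without changing the negative value of
    \<open>qf B\<close>.\<close>
  have a1b: "a1 \<bullet> b2 = 0"
  proof (rule ccontr)
    assume n0: "a1 \<bullet> b2 \<noteq> 0"
    define c where "c = (a1 \<bullet> z) / (a1 \<bullet> b2)"
    have "a1 \<bullet> (z + (- c) *\<^sub>R b2) = 0" using n0 by (simp add: c_def inner_diff_right)
    from semi[OF this] have "0 \<le> qf B z + 2 * (- c) * bil B z b2 + (- c)\<^sup>2 * qf B b2"
      unfolding qf_add_scaleR[OF sym(2)] .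
    then show False using b0 \<mu>[of z] z2 bil_commute[OF sym(2), of z b2] z(2) by simp
  qed
  obtain e where e: "a2 \<bullet> e \<noteq> 0" "a1 \<bullet> e = 0"
    using independent_pair_dual[of a2 a1] ind by (metis add.commute)
  \<comment> \<open>Along \<open>e + c b2\<close>, inside the hyperplane of \<open>a1\<close>,
    \<open>qf B\<close> is affine in \<open>c\<close>; the witness \<open>c\<close> would give it
    the value -1.\<close>
  have "bil B b2 e = 0"
  proof (rule ccontr)
    assume ne: "bil B b2 e \<noteq> 0"
    define c where "c = - (qf B e + 1) / (2 * bil B b2 e)"
    have "a1 \<bullet> (e + c *\<^sub>R b2) = 0" using e a1b by (simp add: inner_right_distrib)
    from semi[OF this] have "0 \<le> qf B e + 2 * c * bil B e b2 + c\<^sup>2 * qf B b2"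
      unfolding qf_add_scaleR[OF sym(2)] .
    moreover have "2 * c * bil B e b2 = - (qf B e + 1)"
      using ne bil_commute[OF sym(2), of e b2] by (simp add: c_def)
    ultimately show False using b0 by simp
  qed
  then have "\<mu> = 0" using \<mu>[of e] e by simp
  then have "(B *v b2) \<bullet> y = 0" for y using \<mu>[of y] inner_mult_eq_bil[OF sym(2)] by simp
  then have "B *v b2 = 0" by (metis inner_eq_zero_iff)
  with a1b show ?thesis by blast
qed

section \<open>The symplectic form and vanishing in the rank-two case\<close>

definition symplectic_J :: "'d::finite phase \<Rightarrow> 'd phase" where
  "symplectic_J z = (\<chi> k. case k of Inl j \<Rightarrow> z $ Inr j | Inr j \<Rightarrow> - z $ Inl j)"

lemma sigma_eq_inner: "sigma z w = symplectic_J z \<bullet> w"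
proof -
  have "symplectic_J z \<bullet> w = (\<Sum>k\<in>range Inl \<union> range Inr. symplectic_J z $ k * w $ k)"
    by (simp add: inner_vec_def UNIV_sum)
  also have "\<dots> = (\<Sum>k\<in>range Inl. symplectic_J z $ k * w $ k) + (\<Sum>k\<in>range Inr. symplectic_J z $ k * w $ k)"
    by (intro sum.union_disjoint) auto
  also have "\<dots> = (\<Sum>j\<in>UNIV. z $ Inr j * w $ Inl j) + (\<Sum>j\<in>UNIV. - z $ Inl j * w $ Inr j)"
    by (simp add: sum.reindex symplectic_J_def)
  finally show ?thesis by (simp add: sigma_def sum_subtractf sum_negf mult.commute)
qed

lemma symplectic_J_simps [simp]:
  "symplectic_J (x + y) = symplectic_J x + symplectic_J y"
  "symplectic_J (c *\<^sub>R x) = c *\<^sub>R symplectic_J x"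
  "symplectic_J 0 = 0"
  "symplectic_J (symplectic_J x) = - x"
  by (auto simp: vec_eq_iff symplectic_J_def split: sum.splits)

lemma symplectic_J_orthogonal: "x \<bullet> symplectic_J x = 0"
  using sigma_eq_inner[of x x] by (simp add: sigma_def inner_commute mult.commute)

text \<open>If \<open>B\<close> is indefinite on both hyperplanes, the two eigen relations give
  \<open>C = (\<mu>1 + \<mu>2) L\<close>. Semidefiniteness on one of them would produce a nonzero
  vector in the radical of \<open>sigma\<close> on the common kernel, which hypothesis
  \<open>K\<close> excludes.\<close>

lemma rank_two_vanishing:
  fixes L B C :: "'d::finite pmat"
  assumes sym: "transpose L = L" "transpose B = B" "transpose C = C" and ip: "indefinite_pencil L B"
    and r: "rank L = 2"
    and iso: "\<And>W. subspace W \<Longrightarrow> (\<And>z. z \<in> W \<Longrightarrow> qf L z = 0 \<and> qf B z = 0) \<Longrightarrow>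
        dim W + 2 < CARD('d + 'd)"
    and \<kappa>: "\<kappa> \<noteq> 0" and C: "\<And>z. qf C z = \<kappa> * sigma (L *v z) (B *v z)"
    and van: "\<And>z. qf L z = 0 \<Longrightarrow> qf B z = 0 \<Longrightarrow> qf C z = 0"
    and K: "\<And>u. L *v u = 0 \<Longrightarrow> B *v u = 0 \<Longrightarrow>
        (\<And>k. L *v k = 0 \<Longrightarrow> B *v k = 0 \<Longrightarrow> sigma u k = 0) \<Longrightarrow> u = 0"
  shows "\<exists>c. C = c *\<^sub>R L"
proof -
  obtain u v where uv: "qf L u > 0" "qf L v < 0" using indefinite_pencil_witnesses[OF ip] .
  obtain a1 a2 where fac: "\<And>z. qf L z = (a1 \<bullet> z) * (a2 \<bullet> z)"
    using rank_two_indefinite_factors[OF sym(1) r uv] by blast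
  \<comment> \<open>Dependent factors would make \<open>qf L\<close> semidefinite.\<close>
  have ind: "s = 0 \<and> t = 0" if st: "s *\<^sub>R a1 + t *\<^sub>R a2 = 0" for s t
  proof (rule ccontr)
    assume "\<not> ?thesis"
    have e: "s * (a1 \<bullet> z) = - t * (a2 \<bullet> z)" for z
      using arg_cong[OF st, of "\<lambda>x. x \<bullet> z"] by (simp add: inner_left_distrib)
    have sq: "s * qf L z = (- t) * (a2 \<bullet> z)\<^sup>2" for z
      using e[of z] by (simp add: fac power2_eq_square) algebra
    have pos: "(a1 \<bullet> u) * (a2 \<bullet> u) > 0" "(a1 \<bullet> v) * (a2 \<bullet> v) < 0" using uv by (simp_all add: fac)
    show False
    proof (cases "s = 0")
      case True
      then show False using \<open>\<not> (s = 0 \<and> t = 0)\<close> e[of u] pos(1) by auto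
    next
      case False
      have "s * s * qf L u = - (s * t) * (a2 \<bullet> u)\<^sup>2" "s * s * qf L v = - (s * t) * (a2 \<bullet> v)\<^sup>2"
        using sq by (simp_all add: mult.assoc)
      moreover have "s * s > 0" using False not_real_square_gt_zero by blast
      ultimately have "- (s * t) * (a2 \<bullet> u)\<^sup>2 > 0" "- (s * t) * (a2 \<bullet> v)\<^sup>2 < 0"
        using uv by (metis mult_pos_pos, metis mult_pos_neg)
      then show False by (smt (verit) mult_nonneg_nonneg mult_nonpos_nonneg zero_le_power2)
    qed
  qed
  have ind': "s = 0 \<and> t = 0" if "s *\<^sub>R a2 + t *\<^sub>R a1 = 0" for s t
    using ind[of t s] that by (simp add: add.commute)
  have Lz: "2 *\<^sub>R (L *v z) = (a1 \<bullet> z) *\<^sub>R a2 + (a2 \<bullet> z) *\<^sub>R a1" for z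
  proof -
    have "2 * bil L z y = (a1 \<bullet> z) * (a2 \<bullet> y) + (a2 \<bullet> z) * (a1 \<bullet> y)" for y
      using qf_add_scaleR[OF sym(1), of z 1 y] fac[of "z + 1 *\<^sub>R y"] fac[of z] fac[of y]
      by (simp add: inner_right_distrib algebra_simps del: bil_simps)
    then have "(2 *\<^sub>R (L *v z) - ((a1 \<bullet> z) *\<^sub>R a2 + (a2 \<bullet> z) *\<^sub>R a1)) \<bullet> y = 0" for y
      by (simp add: inner_diff_left inner_left_distrib inner_mult_eq_bil[OF sym(1)])
    then show ?thesis by (metis inner_eq_zero_iff right_minus_eq)
  qed
  \<comment> \<open>Substituting the formula \<open>Lz\<close> into
    \<open>\<kappa> * sigma (L z) (B z)\<close> leaves these vectors paired with \<open>B z\<close>;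
    the half comes from polarization.\<close>
  define b1 b2 where "b1 = (\<kappa> / 2) *\<^sub>R symplectic_J a1" and "b2 = (\<kappa> / 2) *\<^sub>R symplectic_J a2"
  have Cz: "qf C z = (a1 \<bullet> z) * bil B b2 z + (a2 \<bullet> z) * bil B b1 z" for z
  proof -
    have "2 *\<^sub>R symplectic_J (L *v z) = symplectic_J (2 *\<^sub>R (L *v z))" by simp
    also have "\<dots> = (a1 \<bullet> z) *\<^sub>R symplectic_J a2 + (a2 \<bullet> z) *\<^sub>R symplectic_J a1" unfolding Lz by simp
    finally have "2 * sigma (L *v z) (B *v z) = ((a1 \<bullet> z) *\<^sub>R symplectic_J a2 + (a2 \<bullet> z) *\<^sub>R symplectic_J a1) \<bullet> (B *v z)"
      unfolding sigma_eq_inner by (metis inner_scaleR_left)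
    then have s: "sigma (L *v z) (B *v z) = ((a1 \<bullet> z) *\<^sub>R symplectic_J a2 + (a2 \<bullet> z) *\<^sub>R symplectic_J a1) \<bullet> (B *v z) / 2"
      by simp
    show ?thesis unfolding C s b1_def b2_def by (simp add: bil_def inner_left_distrib algebra_simps)
  qed
  have Cz': "qf C z = (a2 \<bullet> z) * bil B b1 z + (a1 \<bullet> z) * bil B b2 z" for z using Cz[of z] by simp
  have van': "qf C z = 0" if "(a1 \<bullet> z) * (a2 \<bullet> z) = 0" "qf B z = 0" for z using van[of z] that fac by simp
  have orth: "a1 \<bullet> b1 = 0" "a2 \<bullet> b2 = 0" by (simp_all add: b1_def b2_def symplectic_J_orthogonal)
  \<comment> \<open>The common hyperplane section has codimension at most two, too large to be
    isotropic for both forms by \<open>iso\<close>.\<close>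
  obtain n where n: "a1 \<bullet> n = 0" "a2 \<bullet> n = 0" "qf B n \<noteq> 0"
  proof -
    define V where "V = {z. \<forall>x\<in>{a1, a2}. x \<bullet> z = 0}"
    have "card {a1, a2} \<le> 2" by (simp add: card_insert_if)
    then have "CARD('d + 'd) \<le> dim V + 2"
      using dim_orthogonal_to_finite_ge[of "{a1, a2}"] by (simp add: V_def)
    moreover have "subspace V" unfolding V_def by (rule subspace_orthogonal)
    ultimately have "\<not> (\<forall>z\<in>V. qf L z = 0 \<and> qf B z = 0)" using iso[of V] by force
    then show ?thesis using that fac by (auto simp: V_def)
  qed
  have J0: "a = 0" if "(\<kappa> / 2) *\<^sub>R symplectic_J a = 0" for a :: "'d phase"
  proof -
    have "symplectic_J (symplectic_J a) = symplectic_J 0" using that \<kappa> by simp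
    then show ?thesis by simp
  qed
  have ker: "a1 \<bullet> k = 0 \<and> a2 \<bullet> k = 0" if "L *v k = 0" for k
    using Lz[of k] that ind[of "a2 \<bullet> k" "a1 \<bullet> k"] by (simp add: add.commute)
  \<comment> \<open>For \<open>b\<close> a multiple of \<open>symplectic_J a\<close>,
    \<open>sigma b\<close> is a multiple of the inner product with \<open>a\<close>, which vanishes
    on the kernel of \<open>L\<close>.\<close>
  have excl: "\<not> (a1 \<bullet> b = 0 \<and> a2 \<bullet> b = 0 \<and> B *v b = 0)"
    if b: "b = (\<kappa> / 2) *\<^sub>R symplectic_J a" and a: "a \<in> {a1, a2}" for a b
  proof
    assume h: "a1 \<bullet> b = 0 \<and> a2 \<bullet> b = 0 \<and> B *v b = 0"
    have "sigma b k = 0" if "L *v k = 0" for k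
      using ker[OF that] a by (auto simp: sigma_eq_inner b)
    moreover have "L *v b = 0" using Lz[of b] h by simp
    ultimately have "b = 0" using K[of b] h by blast
    then have "a = 0" using J0 b by simp
    then show False using a ind[of 1 0] ind[of 0 1] by auto
  qed
  \<comment> \<open>The sign \<open>s\<close> treats \<open>B\<close> and \<open>- B\<close>
    together, so that \<open>qf B\<close> takes both signs on the hyperplane of
    \<open>a1\<close>.\<close>
  have nonneg1: "\<exists>z. a1 \<bullet> z = 0 \<and> s * qf B z < 0" if s: "s = 1 \<or> s = - 1" for s
  proof (rule ccontr)
    assume no: "\<not> ?thesis"
    have "a1 \<bullet> b2 = 0 \<and> (s *\<^sub>R B) *v b2 = 0"
    proof (rule common_kernel_if_semidefinite[of L "s *\<^sub>R B" "s *\<^sub>R C" a1 a2 b2 b1 n])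
      show "transpose (s *\<^sub>R B) = s *\<^sub>R B" "transpose (s *\<^sub>R C) = s *\<^sub>R C"
        using sym by (simp_all add: transpose_def vec_eq_iff)
      show "indefinite_pencil L (s *\<^sub>R B)" using s ip indefinite_pencil_minus by auto
      show "qf (s *\<^sub>R C) z = (a1 \<bullet> z) * bil (s *\<^sub>R B) b2 z + (a2 \<bullet> z) * bil (s *\<^sub>R B) b1 z" for z
        using Cz[of z] by (simp add: algebra_simps)
      show "0 \<le> qf (s *\<^sub>R B) z" if "a1 \<bullet> z = 0" for z using no that by (auto simp: not_less)
    qed (use sym fac van' ind n orth s in auto)
    then have "B *v b2 = 0" using s by (auto simp: scaleR_matrix_vector_assoc[symmetric])
    then show False using excl[OF b2_def] orth \<open>a1 \<bullet> b2 = 0 \<and> (s *\<^sub>R B) *v b2 = 0\<close> by simp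
  qed
  have nonneg2: "\<exists>z. a2 \<bullet> z = 0 \<and> s * qf B z < 0" if s: "s = 1 \<or> s = - 1" for s
  proof (rule ccontr)
    assume no: "\<not> ?thesis"
    have "a2 \<bullet> b1 = 0 \<and> (s *\<^sub>R B) *v b1 = 0"
    proof (rule common_kernel_if_semidefinite[of L "s *\<^sub>R B" "s *\<^sub>R C" a2 a1 b1 b2 n])
      show "transpose (s *\<^sub>R B) = s *\<^sub>R B" "transpose (s *\<^sub>R C) = s *\<^sub>R C"
        using sym by (simp_all add: transpose_def vec_eq_iff)
      show "indefinite_pencil L (s *\<^sub>R B)" using s ip indefinite_pencil_minus by auto
      show "qf (s *\<^sub>R C) z = (a2 \<bullet> z) * bil (s *\<^sub>R B) b1 z + (a1 \<bullet> z) * bil (s *\<^sub>R B) b2 z" for z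
        using Cz[of z] by (simp add: algebra_simps)
      show "0 \<le> qf (s *\<^sub>R B) z" if "a2 \<bullet> z = 0" for z using no that by (auto simp: not_less)
    qed (use sym fac van' ind' n orth s in auto)
    then have "B *v b1 = 0" using s by (auto simp: scaleR_matrix_vector_assoc[symmetric])
    then show False using excl[OF b1_def] orth \<open>a2 \<bullet> b1 = 0 \<and> (s *\<^sub>R B) *v b1 = 0\<close> by simp
  qed
  obtain u1 v1 where 1: "a1 \<bullet> u1 = 0" "qf B u1 > 0" "a1 \<bullet> v1 = 0" "qf B v1 < 0"
    using nonneg1[of 1] nonneg1[of "- 1"] by auto
  obtain u2 v2 where 2: "a2 \<bullet> u2 = 0" "qf B u2 > 0" "a2 \<bullet> v2 = 0" "qf B v2 < 0"
    using nonneg2[of 1] nonneg2[of "- 1"] by auto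
  obtain \<mu>2 where \<mu>2: "\<And>z. bil B b2 z = \<mu>2 * (a2 \<bullet> z)"
    using eigen_relation_if_indefinite[OF sym(2,3) Cz van' ind n 2] by blast
  obtain \<mu>1 where \<mu>1: "\<And>z. bil B b1 z = \<mu>1 * (a1 \<bullet> z)"
    using eigen_relation_if_indefinite[OF sym(2,3) Cz' van'[unfolded mult.commute[of "a1 \<bullet> _"]] ind' n(2,1,3) 1] by blast
  have "qf (C - (\<mu>1 + \<mu>2) *\<^sub>R L) z = 0" for z
    using Cz[of z] fac[of z] \<mu>1[of z] \<mu>2[of z] by (simp add: algebra_simps)
  moreover have "transpose (C - (\<mu>1 + \<mu>2) *\<^sub>R L) = C - (\<mu>1 + \<mu>2) *\<^sub>R L"
    using sym by (simp add: transpose_def vec_eq_iff)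
  ultimately have "C - (\<mu>1 + \<mu>2) *\<^sub>R L = 0" using matrix_eq_0_iff_qf by blast
  then show ?thesis by (metis right_minus_eq)
qed

section \<open>Poisson brackets of quadratic forms and the final case distinction\<close>

lemma Q_eq_qf: "Q M = qf M"
  by (simp add: Q_def bil_def fun_eq_iff)

text \<open>Each gradient \<open>2 M z\<close> contributes a factor 2, and \<open>sigma\<close>
  pairs the coordinates in the same order as the bracket.\<close>

lemma poisson_qf:
  fixes A B :: "'d::finite pmat"
  assumes sym: "transpose A = A" "transpose B = B"
  shows "poisson (qf A) (qf B) z = 4 * sigma (A *v z) (B *v z)"
proof -
  have "pderiv_coord (qf M) k z = 2 * (M *v z) $ k" if "transpose M = M" for M :: "'d pmat" and k
  proof -
    have "frechet_derivative (qf M) (at z) = (\<lambda>h. 2 * bil M z h)"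
      using frechet_derivative_at[OF qf_has_derivative[OF that]] by simp
    then show ?thesis
      by (simp add: pderiv_coord_def inner_mult_eq_bil[OF that, symmetric] inner_axis)
  qed
  then show ?thesis
    using sym by (simp add: poisson_def sigma_def sum_distrib_left algebra_simps)
qed

theorem theorem1p5:
  fixes A B C :: "'d::finite pmat"
  assumes symA: "symmetric_mat A" and symB: "symmetric_mat B"
    and nd: "non_dissipative_pair A B"
    and symC: "symmetric_mat C"
    and defC: "\<forall>z. Q C z = poisson (Q A) (Q B) z"
    and indep: "\<forall>a b c::real. a *\<^sub>R A + b *\<^sub>R B + c *\<^sub>R C = 0 \<longrightarrow> a = 0 \<and> b = 0 \<and> c = 0"
    and cases: "(minrank A B \<ge> 3 \<and> maxrank A B \<ge> 17) \<or>
                (minrank A B = 2 \<and> maxrank A B \<ge> 9 \<and>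
                   (ker A \<inter> ker B = {0} \<or> symplectic_subspace (ker A \<inter> ker B)))"
  shows "\<exists>x. Q A x = 0 \<and> Q B x = 0 \<and> Q C x \<noteq> 0"
proof (rule ccontr)
  assume "\<not> ?thesis"
  then have van: "qf C z = 0" if "qf A z = 0" "qf B z = 0" for z
    using that by (auto simp: Q_eq_qf)
  have sym: "transpose A = A" "transpose B = B" "transpose C = C"
    using symA symB symC by (simp_all add: symmetric_mat_def)
  have C: "qf C z = 4 * sigma (A *v z) (B *v z)" for z
    using defC poisson_qf[OF sym(1,2)] by (simp add: Q_eq_qf)
  have indAB: "s = 0 \<and> t = 0" if "s *\<^sub>R A + t *\<^sub>R B = 0" for s t
    using indep[rule_format, of s t 0] that by simp
  have notspan: False if "C = a *\<^sub>R A + b *\<^sub>R B" for a b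
    using indep[rule_format, of a b "- 1"] that by simp
  have ip: "indefinite_pencil A B"
    unfolding indefinite_pencil_def
  proof (intro allI impI)
    fix s t assume "\<forall>z. 0 \<le> s * qf A z + t * qf B z"
    then have "psd (s *\<^sub>R A + t *\<^sub>R B)" by (simp add: psd_def Q_eq_qf)
    then have "s *\<^sub>R A + t *\<^sub>R B = 0" using nd by (auto simp: non_dissipative_pair_def span2_def)
    then show "s = 0 \<and> t = 0" by (rule indAB)
  qed
  \<comment> \<open>Ranks are bounded, so the maximum and minimum in \<open>maxrank\<close> and
    \<open>minrank\<close> are attained.\<close>
  have "rank M \<le> CARD('d + 'd)" for M :: "'d pmat" using rank_bound[of M] by linarith
  then have "rank ` S \<subseteq> {..CARD('d + 'd)}" for S :: "'d pmat set" by blast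
  then have fin: "finite (rank ` S)" for S :: "'d pmat set"
    by (meson finite_atMost finite_subset)
  have "maxrank A B \<in> rank ` span2 A B"
    unfolding maxrank_def by (intro Max_in fin) (auto simp: span2_def)
  then obtain s0 t0 where max: "rank (s0 *\<^sub>R A + t0 *\<^sub>R B) = maxrank A B" by (auto simp: span2_def)
  have A0: "A \<noteq> 0" using indAB[of 1 0] by auto
  have "A = 1 *\<^sub>R A + 0 *\<^sub>R B" by simp
  then have "A \<in> span2 A B - {0}" using A0 unfolding span2_def by blast
  then have "minrank A B \<in> rank ` (span2 A B - {0})"
    unfolding minrank_def by (intro Min_in fin) auto
  then obtain M where "M \<in> span2 A B - {0}" "minrank A B = rank M" by (rule imageE)
  then obtain a b where min: "rank (a *\<^sub>R A + b *\<^sub>R B) = minrank A B" "a *\<^sub>R A + b *\<^sub>R B \<noteq> 0"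
    unfolding span2_def by fastforce
  have min_le: "minrank A B \<le> rank (s *\<^sub>R A + t *\<^sub>R B)" if "(s, t) \<noteq> (0, 0)" for s t
    unfolding minrank_def using indAB[of s t] that by (intro Min_le fin) (auto simp: span2_def)
  from cases show False
  proof
    assume r: "3 \<le> minrank A B \<and> 17 \<le> maxrank A B"
    obtain x where x: "regular_zero A B x"
      using exists_regular_zero[OF sym(1,2) ip, of s0 t0] max r by auto
    have "\<exists>a b. C = a *\<^sub>R A + b *\<^sub>R B"
    proof (rule vanishing_form_in_pencil[OF sym x])
      show "3 \<le> rank (s *\<^sub>R A + t *\<^sub>R B)" if "(s, t) \<noteq> (0, 0)" for s t
        using min_le[OF that] r by linarith
      show "5 \<le> rank (s0 *\<^sub>R A + t0 *\<^sub>R B)" using max r by linarith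
    qed (rule van)
    then show False using notspan by blast
  next
    assume r: "minrank A B = 2 \<and> 9 \<le> maxrank A B \<and>
      (ker A \<inter> ker B = {0} \<or> symplectic_subspace (ker A \<inter> ker B))"
    \<comment> \<open>The pencil is rotated so that the form of rank two becomes its first
      generator.\<close>
    have ab: "(a, b) \<noteq> (0, 0)" using min(2) by auto
    let ?L = "a *\<^sub>R A + b *\<^sub>R B" and ?N = "- b *\<^sub>R A + a *\<^sub>R B"
    define D where "D = a\<^sup>2 + b\<^sup>2"
    have D: "D \<noteq> 0" using ab by (simp add: D_def sum_power2_eq_zero_iff)
    have orig: "qf A z = 0 \<and> qf B z = 0" if "qf ?L z = 0" "qf ?N z = 0" for z
      using basis_change_nonzero[OF ab, of "qf A z" "- qf B z"] that by (simp add: algebra_simps)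
    have mv: "?L *v z = a *\<^sub>R (A *v z) + b *\<^sub>R (B *v z)" "?N *v z = - b *\<^sub>R (A *v z) + a *\<^sub>R (B *v z)" for z
      by (simp_all only: matrix_vector_mult_add_rdistrib scaleR_matrix_vector_assoc[symmetric])
    have kerAB: "A *v z = 0 \<and> B *v z = 0" if "?L *v z = 0" "?N *v z = 0" for z
    proof -
      have "D *\<^sub>R (A *v z) = a *\<^sub>R (?L *v z) - b *\<^sub>R (?N *v z)" "D *\<^sub>R (B *v z) = b *\<^sub>R (?L *v z) + a *\<^sub>R (?N *v z)"
        unfolding mv D_def by (simp_all add: algebra_simps power2_eq_square)
      then show ?thesis using that D by simp
    qed
    have "\<exists>c. C = c *\<^sub>R ?L"
    \<comment> \<open>The rotation multiplies \<open>sigma (A z) (B z)\<close> by its determinant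
      \<open>D\<close>, whence \<open>4 / D\<close>.\<close>
    proof (rule rank_two_vanishing[where B = ?N and \<kappa> = "4 / D"])
      show "transpose ?L = ?L" "transpose ?N = ?N" by (rule transpose_combination(1)[OF sym(1,2)])+
      show "indefinite_pencil ?L ?N" by (rule indefinite_pencil_basis_change[OF ip ab])
      show "rank ?L = 2" using min r by simp
      show "4 / D \<noteq> 0" using D by simp
      show "dim W + 2 < CARD('d + 'd)"
        if W: "subspace W" "\<And>z. z \<in> W \<Longrightarrow> qf ?L z = 0 \<and> qf ?N z = 0" for W
      proof -
        have "qf (s0 *\<^sub>R A + t0 *\<^sub>R B) z = 0" if "z \<in> W" for z
          using orig[of z] W(2)[OF that] by simp
        \<comment> \<open>With rank at least 9, a common isotropic subspace has codimension at least
          5.\<close>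
        from rank_isotropic_subspace[OF transpose_combination(1)[OF sym(1,2)] W(1) this]
        show ?thesis using max r by linarith
      qed
      show "qf C z = 4 / D * sigma (?L *v z) (?N *v z)" for z
      proof -
        have alt: "sigma x x = 0" "sigma y x = - sigma x y" for x y :: "'d phase"
          by (simp_all add: sigma_def sum_negf[symmetric] mult.commute)
        have "sigma (?L *v z) (?N *v z) = D * sigma (A *v z) (B *v z)"
          using alt(1)[of "A *v z"] alt(1)[of "B *v z"] alt(2)[of "B *v z" "A *v z"]
          unfolding mv by (simp add: sigma_eq_inner inner_left_distrib inner_right_distrib D_def
              inner_diff_right algebra_simps power2_eq_square)
        then show ?thesis using C[of z] D by simp
      qed
      show "qf C z = 0" if "qf ?L z = 0" "qf ?N z = 0" for z using orig[OF that] van by blast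
      show "u = 0" if u: "?L *v u = 0" "?N *v u = 0"
        "\<And>k. ?L *v k = 0 \<Longrightarrow> ?N *v k = 0 \<Longrightarrow> sigma u k = 0" for u
      proof -
        \<comment> \<open>If the common kernel is trivial, membership alone gives
          \<open>u = 0\<close>; otherwise nondegeneracy of \<open>sigma\<close> on it does.\<close>
        have uK: "u \<in> ker A \<inter> ker B" using kerAB[OF u(1,2)] by (simp add: ker_def)
        have "sigma u k = 0" if "k \<in> ker A \<inter> ker B" for k
          using that by (intro u(3)) (simp_all only: mv, simp_all add: ker_def)
        then show ?thesis using r uK unfolding symplectic_subspace_def by blast
      qed
    qed (rule sym(3))
    then obtain c where "C = c *\<^sub>R ?L" by blast
    then have "C = (c * a) *\<^sub>R A + (c * b) *\<^sub>R B" by (simp add: scaleR_right_distrib)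
    then show False by (rule notspan)
  qed
qed

end
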